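(* Let $P(z), Q(z)\in\mathbb{C}[z]$ be complex polynomials with $P$ non-constant, and let $a,b$ be distinct complex numbers such that $P(a)=P(b)$. Let $d_a$ (resp. $d_b$) be the multiplicity of the point $a$ (resp. $b$) with respect to $P(z)$. Suppose that $$\int_a^b P^i(z)\, Q^j(z)\, Q'(z)\, dz = 0$$ for all integers $i\geq 0$ and all integers $j$ with $0\leq j\leq d_a+d_b-2$. Then there exist polynomials $\tilde P(z), \tilde Q(z), W(z)\in\mathbb{C}[z]$ such that $$P(z)=\tilde P(W(z)),\qquad Q(z)=\tilde Q(W(z)),\qquad W(a)=W(b).$$
   Context: For a non-constant polynomial $P(z)$ and a point $c\in\mathbb{C}$, the multiplicity of $c$ with respect to $P$ is the order of vanishing of $P(z)-P(c)$ at $z=c$ (so it equals $1$ exactly when $c$ is not a critical point of $P$). Here $P^i(z)$ and $Q^j(z)$ denote powers, and the integral is taken along any path in $\mathbb{C}$ from $a$ to $b$. *)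

theory Defs
  imports
    "HOL-Complex_Analysis.Complex_Analysis"
    "HOL-Computational_Algebra.Polynomial"
begin

definition point_multiplicity :: "complex poly \<Rightarrow> complex \<Rightarrow> nat" where
  "point_multiplicity P c = order c (P - [:poly P c:])"

(* For non-constant P the multiplicity is at least 1, so the truncated subtraction in
   point_multiplicity P a + point_multiplicity P b - 2 is the true difference. *)
lemma point_multiplicity_pos:
  assumes "degree P > 0"
  shows "point_multiplicity P c \<ge> 1"
proof -
  have "P - [:poly P c:] \<noteq> 0"
    using assms by (metis degree_pCons_0 eq_iff_diff_eq_0 less_irrefl)
  moreover have "poly (P - [:poly P c:]) c = 0" by simp
  ultimately have "order c (P - [:poly P c:]) \<noteq> 0"
    using order_root by blast
  then show ?thesis unfolding point_multiplicity_def by simp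
qed

end

theory Submission
  imports Defs
    "HOL-Computational_Algebra.Polynomial_Factorial"
    "HOL-Computational_Algebra.Field_as_Ring"
    "HOL-Computational_Algebra.Fundamental_Theorem_Algebra"
    "HOL-Combinatorics.Cycles"
    "HOL-Real_Asymp.Real_Asymp"
begin

text \<open>
  Put p = P - P(a). For large t the vanishing moments say that the integral of f p' / (p - t) from
  a to b is zero, where f is a power of Q. A partial fraction expansion turns this integral into a
  sum, over the roots z of p(z) = t, of a polynomial in z plus f(z) log ((z - b) / (z - a)). With
  t = exp w, the roots and logarithms continue holomorphically along a strip avoiding the critical
  values into a half plane Re w < -M. There a translation by a suitable multiple of 2 pi i fixes
  every root, but changes the logarithm for the roots tending to a or to b as t tends to 0.
  Comparing the identity before and after the translation shows that the mean of f over the d_a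
  roots near a equals its mean over the d_b roots near b. Since this holds for enough powers f of Q,
  a Vandermonde argument makes Q take the same value at a root near a and at a root near b.

  The polynomials that agree along two such coincident root sequences form a subalgebra closed under
  exact division. By an argument in the style of Lueroth's theorem it consists of the polynomials in
  one element W; it contains P and Q, and letting the sequences tend to a and b gives W(a) = W(b).
\<close>

section \<open>Subalgebras of the polynomial ring closed under exact division\<close>

text \<open>Polynomials with polynomial coefficients are read as polynomials in T over R[X]. There
  \<open>map_poly (\<lambda>c. [:c:]) F\<close> is F(T), \<open>[:F:]\<close> is F(X), and
  evaluation at \<open>[:0, 1:]\<close> substitutes T = X.\<close>

lemma poly_map_poly_const_X: "poly (map_poly (\<lambda>c. [:c:]) F) [:0, 1:] = (F :: 'a::comm_ring_1 poly)"
  by (induction F) (auto simp: map_poly_pCons)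

lemma poly_map_poly_const_const:
  "poly (map_poly (\<lambda>c. [:c:]) F) [:x:] = [:poly F (x :: 'a::comm_ring_1):]"
  by (induction F) (auto simp: map_poly_pCons)

lemma coeff_poly_const:
  "coeff (poly M [:c:]) m = poly (map_poly (\<lambda>p. coeff p m) M) (c :: 'a::comm_ring_1)"
  by (induction M) (auto simp: map_poly_pCons)

lemma degree_map_poly_const_minus:
  fixes F :: "'a::comm_ring_1 poly"
  assumes "degree F > 0"
  shows "degree (map_poly (\<lambda>c. [:c:]) F - [:F:]) = degree F"
    and "lead_coeff (map_poly (\<lambda>c. [:c:]) F - [:F:]) = [:lead_coeff F:]"
proof -
  have d: "degree (map_poly (\<lambda>c. [:c:]) F) = degree F" 
    by (rule map_poly_degree_eq) (use assms in auto)
  have c: "coeff (map_poly (\<lambda>c. [:c:]) F - [:F:]) (degree F) = [:lead_coeff F:]"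
    using assms by (simp add: coeff_map_poly coeff_pCons split: nat.split)
  have "degree (map_poly (\<lambda>c. [:c:]) F - [:F:]) \<le> degree F"
    by (rule degree_diff_le) (auto simp: d)
  moreover have "degree F \<le> degree (map_poly (\<lambda>c. [:c:]) F - [:F:])"
    by (rule le_degree) (use assms c in auto)
  ultimately show *: "degree (map_poly (\<lambda>c. [:c:]) F - [:F:]) = degree F" by simp
  show "lead_coeff (map_poly (\<lambda>c. [:c:]) F - [:F:]) = [:lead_coeff F:]"
    using c by (simp add: *)
qed

text \<open>Pseudo-division: scaling F by the leading coefficient of B before subtracting a multiple
  of B removes the top term without any division, so the coefficients stay in A and the remainder
  still vanishes at X. By minimality no nonzero remainder has degree below that of B, so the process
  can only end at zero.\<close>

lemma pseudo_dvd_of_minimal_degree: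
  fixes A :: "'a::idom set" and B F :: "'a poly"
  assumes diff: "\<And>x y. x \<in> A \<Longrightarrow> y \<in> A \<Longrightarrow> x - y \<in> A"
    and mult: "\<And>x y. x \<in> A \<Longrightarrow> y \<in> A \<Longrightarrow> x * y \<in> A"
    and B: "\<And>i. coeff B i \<in> A" "poly B X = 0" "B \<noteq> 0"
    and min: "\<And>G. (\<And>i. coeff G i \<in> A) \<Longrightarrow> poly G X = 0 \<Longrightarrow> G \<noteq> 0 \<Longrightarrow> degree B \<le> degree G"
    and F: "\<And>i. coeff F i \<in> A" "poly F X = 0"
  shows "\<exists>k. B dvd smult (lead_coeff B ^ k) F"
  using F
proof (induction "degree F" arbitrary: F rule: less_induct)
  case less
  show ?case
  proof (cases "F = 0")
    case False
    define m where "m = degree F - degree B"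
    have le: "degree B \<le> degree F" using min less.prems False by blast
    have zero: "0 \<in> A" using diff[OF B(1) B(1), of 0 0] by simp
    define G where "G = smult (lead_coeff B) F - monom (lead_coeff F) m * B"
    have GA: "coeff G i \<in> A" for i
      unfolding G_def using zero less.prems(1) B(1) mult diff by (auto simp: coeff_monom_mult)
    have GX: "poly G X = 0" using less.prems(2) B(2) by (simp add: G_def)
    \<comment> \<open>For F of degree 0 no drop is possible; there the vanishing coefficient makes G
      itself zero.\<close>
    have dG: "degree G < degree F \<or> G = 0"
    proof -
      have "degree (monom (lead_coeff F) m * B) \<le> degree F"
        using degree_mult_le[of "monom (lead_coeff F) m" B] le degree_monom_le[of "lead_coeff F" m]
        by (simp add: m_def)
      then have "degree G \<le> degree F" unfolding G_def
        by (intro degree_diff_le) (auto intro: order.trans[OF degree_smult_le])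
      moreover have "coeff G (degree F) = 0"
        using le by (simp add: G_def coeff_monom_mult m_def)
      ultimately show ?thesis using eq_zero_or_degree_less by blast
    qed
    have "\<exists>k. B dvd smult (lead_coeff B ^ k) G"
      using dG less.hyps[OF _ GA GX] by auto
    then obtain k where "B dvd smult (lead_coeff B ^ k) G" by blast
    then have "B dvd smult (lead_coeff B ^ k) G + B * smult (lead_coeff B ^ k) (monom (lead_coeff F) m)"
      by (rule dvd_add) (simp add: dvd_smult)
    also have "\<dots> = smult (lead_coeff B ^ Suc k) F"
      by (simp add: G_def smult_diff_right algebra_simps)
    finally show ?thesis by blast
  qed auto
qed

text \<open>Gauss's lemma. A unit leading coefficient makes F primitive, so for the cofactor q both
  \<open>content B * content q\<close> and \<open>lead_coeff B * lead_coeff q\<close> equal c up to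
  units. Since \<open>content q\<close> divides \<open>lead_coeff q\<close>, it can be
  cancelled.\<close>

lemma lead_coeff_dvd_content:
  fixes B F :: "'a::{factorial_ring_gcd,semiring_gcd_mult_normalize} poly"
  assumes dvd: "B dvd smult c F" and "c \<noteq> 0" and unit: "is_unit (lead_coeff F)"
  shows "lead_coeff B dvd content B"
proof -
  obtain q where q: "smult c F = B * q" using dvd by blast
  have cF: "content F dvd 1" using content_dvd_coeff[of F] unit dvd_trans by blast
  then have "content F = 1" by (metis is_unit_normalize normalize_content)
  then have "normalize c = content B * content q"
    by (metis content_mult content_smult mult.right_neutral q)
  moreover have lc: "c * lead_coeff F = lead_coeff B * lead_coeff q"
    by (metis lead_coeff_mult lead_coeff_smult q)
  ultimately have "lead_coeff B * lead_coeff q dvd content B * content q"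
    using unit by (metis associated_unit dvd_mult_unit_iff dvd_normalize_iff dvd_refl)
  moreover have "content q dvd lead_coeff q" by simp
  moreover have "q \<noteq> 0" using q \<open>c \<noteq> 0\<close> unit by auto
  ultimately have "lead_coeff B * content q dvd content B * content q"
    by (meson dvd_refl dvd_trans mult_dvd_mono)
  then show ?thesis using \<open>q \<noteq> 0\<close> by simp
qed

theorem subalgebra_eq_polynomials_in_generator:
  fixes A :: "complex poly set"
  assumes const: "\<And>c. [:c:] \<in> A"
    and add: "\<And>F G. F \<in> A \<Longrightarrow> G \<in> A \<Longrightarrow> F + G \<in> A"
    and mult: "\<And>F G. F \<in> A \<Longrightarrow> G \<in> A \<Longrightarrow> F * G \<in> A"
    and cancel: "\<And>F G. G \<in> A \<Longrightarrow> G \<noteq> 0 \<Longrightarrow> G * F \<in> A \<Longrightarrow> F \<in> A"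
    and P: "P \<in> A" "degree P > 0"
  obtains V where "V \<in> A" "\<And>F. F \<in> A \<Longrightarrow> \<exists>R. F = pcompose R V"
proof -
  have diff: "F - G \<in> A" if "F \<in> A" "G \<in> A" for F G
    using add[OF that(1) mult[OF const[of "-1"] that(2)]] by simp
  have zero: "0 \<in> A" using const[of 0] by simp
  define X where "X = [:0, 1 :: complex:]"
  define L where "L F = map_poly (\<lambda>c. [:c:]) F - [:F:]" for F :: "complex poly"
  have LA: "coeff (L F) i \<in> A" if "F \<in> A" for F i
    unfolding L_def using that const zero
    by (auto simp: coeff_map_poly coeff_pCons split: nat.splits intro!: diff)
  have LX: "poly (L F) X = 0" for F by (simp add: L_def X_def poly_map_poly_const_X)
  \<comment> \<open>\<open>M\<close> below plays the role of the minimal polynomial of \<open>X\<close> over the fraction field of \<open>A\<close>;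
    the content argument keeps its coefficients inside \<open>A\<close>. It divides \<open>F(T) - F(X)\<close> for every
    \<open>F \<in> A\<close>, so specialising \<open>T\<close> to a constant yields the generator.\<close>
  define S where "S = {B. (\<forall>i. coeff B i \<in> A) \<and> poly B X = 0 \<and> B \<noteq> 0}"
  have LPS: "L P \<in> S"
    using LA[OF P(1)] LX degree_map_poly_const_minus[OF P(2)] P(2) unfolding S_def L_def by auto
  then obtain B where BS: "B \<in> S" and min: "\<And>G. G \<in> S \<Longrightarrow> degree B \<le> degree G"
    using arg_min_natI[of "\<lambda>B. B \<in> S" "L P" degree] arg_min_nat_le[of "\<lambda>B. B \<in> S" _ degree] by metis
  define b where "b = lead_coeff B"
  have b: "b \<noteq> 0" "b \<in> A" using BS by (auto simp: b_def S_def)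
  obtain k where "B dvd smult (b ^ k) (L P)"
    using pseudo_dvd_of_minimal_degree[of A B X "L P"] BS LPS min diff mult unfolding S_def b_def by auto
  \<comment> \<open>The leading coefficient of \<open>L P\<close> is the nonzero constant
    \<open>[:lead_coeff P:]\<close>, a unit of C[X]. Hence b divides every coefficient of B, and
    exact division in A turns B into a monic M over A.\<close>
  then have "b dvd content B" unfolding b_def
  proof (rule lead_coeff_dvd_content)
    show "lead_coeff B ^ k \<noteq> 0" using b by (simp add: b_def)
    show "is_unit (lead_coeff (L P))"
      using degree_map_poly_const_minus(2)[OF P(2)] P(2)
      by (auto simp: L_def is_unit_const_poly_iff dvd_field_iff)
  qed
  then have "[:b:] dvd B" by (metis const_poly_dvd_iff_dvd_content)
  then obtain M where M: "B = smult b M" by auto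
  have MA: "coeff M i \<in> A" for i
    using cancel[OF b(2,1), of "coeff M i"] BS by (auto simp: S_def M)
  have MX: "poly M X = 0" using BS b by (simp add: S_def M)
  have lM: "lead_coeff M = 1"
    using b by (metis b_def M lead_coeff_smult mult_cancel_left1)
  have dM: "degree M = degree B" using M b by simp
  \<comment> \<open>For the monic M the factor produced by pseudo-division is 1, so this is genuine
    divisibility.\<close>
  have M_dvd: "M dvd L F" if "F \<in> A" for F
  proof -
    have "\<exists>k. M dvd smult (lead_coeff M ^ k) (L F)"
      by (rule pseudo_dvd_of_minimal_degree[where A = A and X = X])
         (use diff mult MA MX lM LA[OF that] LX min in \<open>auto simp: S_def dM\<close>)
    then show ?thesis by (simp add: lM)
  qed
  \<comment> \<open>If all specialisations were constant, M would have complex coefficients; its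
    vanishing at the transcendental X would then force M = 0, although M is monic.\<close>
  have "\<exists>c. degree (poly M [:c:]) > 0"
  proof (rule ccontr)
    assume "\<not> ?thesis"
    then have d0: "degree (poly M [:c:]) = 0" for c by auto
    have "map_poly (\<lambda>p. coeff p m) M = 0" if "m > 0" for m
    proof -
      have "poly (map_poly (\<lambda>p. coeff p m) M) c = 0" for c
        using d0[of c] that by (metis coeff_poly_const coeff_eq_0)
      then show ?thesis using poly_all_0_iff_0 by blast
    qed
    then have "coeff (coeff M i) m = 0" if "m > 0" for i m
      using that by (metis coeff_0 coeff_map_poly)
    then have "coeff M i = [:coeff (coeff M i) 0:]" for i
      by (intro poly_eqI) (auto simp: coeff_pCons split: nat.splits)
    then have "M = map_poly (\<lambda>c. [:c:]) (map_poly (\<lambda>p. coeff p 0) M)"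
      by (intro poly_eqI) (simp add: coeff_map_poly)
    then have "map_poly (\<lambda>p. coeff p 0) M = 0"
      using MX by (metis X_def poly_map_poly_const_X)
    then have "M = 0" using \<open>M = map_poly _ _\<close> by simp
    then show False using lM by simp
  qed
  then obtain c where c: "degree (poly M [:c:]) > 0" by blast
  define V where "V = poly M [:c:]"
  have V0: "V \<noteq> 0" using c by (auto simp: V_def)
  have VA: "V \<in> A"
  proof -
    have "poly G [:c:] \<in> A" if "\<And>i. coeff G i \<in> A" for G
      using that
    proof (induction G)
      case (pCons x G)
      have "coeff G i \<in> A" for i using pCons.prems[of "Suc i"] by simp
      moreover have "x \<in> A" using pCons.prems[of 0] by simp
      ultimately show ?case using pCons.IH mult[OF const[of c]] add by simp
    qed (auto simp: zero)
    then show ?thesis using MA by (simp add: V_def)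
  qed
  \<comment> \<open>Descent on the degree: V divides F - F(c), and the quotient lies in A again by
    exact division. The coefficients of R are read off one at a time, as in an expansion in base
    V.\<close>
  have "\<exists>R. F = pcompose R V" if "F \<in> A" for F
    using that
  proof (induction "degree F" arbitrary: F rule: less_induct)
    case less
    show ?case
    proof (cases "degree F = 0")
      case True
      then obtain x where "F = [:x:]" by (metis degree_eq_zeroE)
      then have "F = pcompose [:x:] V" by simp
      then show ?thesis by blast
    next
      case False
      have "poly M [:c:] dvd poly (L F) [:c:]"
        using M_dvd[OF less.prems] by (metis dvdE dvd_triv_left poly_mult)
      then have "V dvd [:poly F c:] - F" by (simp add: V_def L_def poly_map_poly_const_const)
      then have "V dvd F - [:poly F c:]" by (metis dvd_minus_iff minus_diff_eq)
      then obtain G where G: "F - [:poly F c:] = V * G" by blast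
      then have GA: "G \<in> A" using cancel[OF VA V0] diff[OF less.prems const] by metis
      have FG: "F = [:poly F c:] + V * G" using G by (simp add: algebra_simps)
      have "G \<noteq> 0" using FG False by (metis add.right_neutral degree_pCons_0 mult_zero_right)
      then have dVG: "degree (V * G) = degree V + degree G"
        by (simp add: V0 degree_mult_eq)
      moreover have "degree ([:poly F c:] + V * G) = degree (V * G)"
        by (rule degree_add_eq_right) (use dVG c in \<open>simp add: V_def\<close>)
      ultimately have "degree F = degree V + degree G" using FG by simp
      then have "degree G < degree F" using c by (simp add: V_def)
      then obtain R where "G = pcompose R V" using less.hyps GA by blast
      then have "F = pcompose (pCons (poly F c) R) V" using FG by (simp add: pcompose_pCons)
      then show ?thesis by blast
    qed
  qed
  then show ?thesis using VA that by blast
qed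

section \<open>Analytic branches of the roots of a polynomial\<close>

lemma rsquarefree_minus_const:
  fixes p :: "complex poly"
  assumes "\<And>z. poly p z = t \<Longrightarrow> poly (pderiv p) z \<noteq> 0"
  shows "rsquarefree (p - [:t:])"
  using assms by (auto simp: rsquarefree_roots pderiv_diff pderiv_pCons)

lemma degree_minus_const: "degree (p - [:t:]) = degree (p :: 'a::ab_group_add poly)"
  by (cases p) simp

lemma finite_poly_fibre:
  fixes p :: "complex poly"
  assumes "degree p > 0"
  shows "finite {z. poly p z = t}" "card {z. poly p z = t} \<le> degree p"
proof -
  have deg: "degree (p - [:t:]) = degree p"
    by (rule degree_minus_const)
  then have nz: "p - [:t:] \<noteq> 0" using assms by auto
  have "{z. poly p z = t} = {z. poly (p - [:t:]) z = 0}" by auto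
  then show "finite {z. poly p z = t}" "card {z. poly p z = t} \<le> degree p"
    using poly_roots_finite[OF nz] card_poly_roots_bound[OF nz] deg by metis+
qed

lemma poly_minus_const_decompose:
  fixes p :: "complex poly"
  assumes deg: "degree p > 0" and reg: "\<And>z. poly p z = t \<Longrightarrow> poly (pderiv p) z \<noteq> 0"
  shows "p - [:t:] = smult (lead_coeff p) (\<Prod>z | poly p z = t. [:-z, 1:])"
    and "card {z. poly p z = t} = degree p"
proof -
  have d: "degree (p - [:t:]) = degree p" 
    by (rule degree_minus_const)
  have "lead_coeff (p - [:t:]) = lead_coeff p" using deg unfolding d
    by (simp add: coeff_eq_0)
  moreover have "{z. poly (p - [:t:]) z = 0} = {z. poly p z = t}" by auto
  moreover have "smult (lead_coeff (p - [:t:])) (\<Prod>z | poly (p - [:t:]) z = 0. [:-z, 1:]) = p - [:t:]"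
    by (rule complex_poly_decompose_rsquarefree) (rule rsquarefree_minus_const[OF reg])
  ultimately show *: "p - [:t:] = smult (lead_coeff p) (\<Prod>z | poly p z = t. [:-z, 1:])"
    by metis
  have "degree p = degree (smult (lead_coeff p) (\<Prod>z | poly p z = t. [:-z, 1:]))"
    using d * by simp
  also have "\<dots> = card {z. poly p z = t}"
    using deg by (auto simp: degree_prod_sum_eq)
  finally show "card {z. poly p z = t} = degree p" by simp
qed

lemma finite_disjoint_balls:
  fixes Z :: "'a::metric_space set"
  assumes "finite Z"
  obtains r where "r > 0"
    "\<And>z z'. z \<in> Z \<Longrightarrow> z' \<in> Z \<Longrightarrow> z \<noteq> z' \<Longrightarrow> ball z r \<inter> ball z' r = {}"
proof -
  have "\<exists>d>0. \<forall>z'\<in>Z. z \<noteq> z' \<longrightarrow> d \<le> dist z z'" for z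
    using finite_set_avoid[OF assms, of z] by metis
  then obtain d where d: "\<And>z. d z > 0" "\<And>z z'. z' \<in> Z \<Longrightarrow> z \<noteq> z' \<Longrightarrow> d z \<le> dist z z'"
    by metis
  \<comment> \<open>The entry 1 keeps the minimum meaningful when Z is empty; centres at distance at
    least 2 r have disjoint balls of radius r.\<close>
  define r where "r = Min (insert 1 (d ` Z)) / 2"
  have r: "r > 0" "\<And>z. z \<in> Z \<Longrightarrow> 2 * r \<le> d z"
    using assms d(1) by (auto simp: r_def)
  have "ball z r \<inter> ball z' r = {}" if "z \<in> Z" "z' \<in> Z" "z \<noteq> z'" for z z'
    by (rule disjoint_ballI) (use d(2)[OF that(2,3)] r(2)[OF that(1)] in simp)
  then show ?thesis using r(1) that by blast
qed

section \<open>The covering defined by p and lifts of exp through it\<close>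

lemma covering_space_poly:
  fixes p :: "complex poly"
  assumes deg: "degree p > 0"
  defines "CV \<equiv> poly p ` {z. poly (pderiv p) z = 0}"
  shows "covering_space (poly p -` (- CV)) (poly p) (- CV)"
proof
  have "pderiv p \<noteq> 0" using deg by (simp add: pderiv_eq_0_iff)
  then have "finite CV" unfolding CV_def using poly_roots_finite by blast
  then have open_CV: "open (- CV)" by (simp add: finite_imp_closed open_Compl)
  have cont: "continuous_on S (poly p)" for S by (intro continuous_intros)
  show "continuous_on (poly p -` (- CV)) (poly p)" by (rule cont)
  show "poly p ` (poly p -` (- CV)) = - CV"
  proof safe
    fix t assume "t \<notin> CV"
    obtain z where "poly (p - [:t:]) z = 0"
      using deg alg_closed_imp_poly_has_root[of "p - [:t:]"] by (auto simp: degree_minus_const)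
    then show "t \<in> poly p ` (poly p -` (- CV))" using \<open>t \<notin> CV\<close> by (intro image_eqI[of _ _ z]) auto
  qed
  fix t assume t: "t \<in> - CV"
  define Z where "Z = {z. poly p z = t}"
  have finZ: "finite Z" unfolding Z_def using finite_poly_fibre[OF deg] by blast
  have reg: "poly (pderiv p) z \<noteq> 0" if "poly p z = t" for z
    using t that by (auto simp: CV_def)
  have cardZ: "card Z = degree p"
    unfolding Z_def by (rule poly_minus_const_decompose(2)[OF deg reg])
  obtain r0 where r0: "r0 > 0"
    "\<And>z z'. z \<in> Z \<Longrightarrow> z' \<in> Z \<Longrightarrow> z \<noteq> z' \<Longrightarrow> ball z r0 \<inter> ball z' r0 = {}"
    using finite_disjoint_balls[OF finZ] by blast
  have "\<exists>r. 0 < r \<and> r \<le> r0 \<and> inj_on (poly p) (ball z r)" if "z \<in> Z" for z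
  proof -
    have "deriv (poly p) z \<noteq> 0"
      using reg that by (simp add: Z_def DERIV_imp_deriv[OF poly_DERIV])
    moreover have "poly p holomorphic_on UNIV" by (intro holomorphic_intros)
    ultimately obtain r where "r > 0" "inj_on (poly p) (ball z r)"
      using has_complex_derivative_locally_injective[of "poly p" UNIV z] by auto
    then have "inj_on (poly p) (ball z (min r r0))"
      by (meson inj_on_subset min.cobounded1 subset_ball)
    then show ?thesis using r0(1) \<open>r > 0\<close> by (intro exI[of _ "min r r0"]) simp
  qed
  then obtain r where r: "\<And>z. z \<in> Z \<Longrightarrow> 0 < r z \<and> r z \<le> r0 \<and> inj_on (poly p) (ball z (r z))"
    by metis
  define T where "T = - CV \<inter> (\<Inter>z\<in>Z. poly p ` ball z (r z))"
  have "open (poly p ` ball z (r z))" if "z \<in> Z" for z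
    by (rule invariance_of_domain) (use r[OF that] cont in auto)
  then have "open T" unfolding T_def using finZ open_CV by auto
  define U where "U z = ball z (r z) \<inter> poly p -` T" for z
  have openU: "open (U z)" for z
    unfolding U_def using \<open>open T\<close> by (intro open_Int open_ball open_vimage) (auto intro: continuous_intros)
  have U_subset: "U z \<subseteq> ball z r0" if "z \<in> Z" for z
    using subset_ball[of "r z" r0 z] r[OF that] unfolding U_def by blast
  have disj: "U z \<inter> U z' = {}" if "z \<in> Z" "z' \<in> Z" "z \<noteq> z'" for z z'
    using U_subset[OF that(1)] U_subset[OF that(2)] r0(2)[OF that] by blast
  have imU: "poly p ` U z = T" if "z \<in> Z" for z
    using that unfolding U_def T_def by blast
  have union: "\<Union> (U ` Z) = poly p -` T"
  proof
    show "poly p -` T \<subseteq> \<Union> (U ` Z)"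
    proof
      fix x assume "x \<in> poly p -` T"
      then have x: "poly p x \<in> T" by simp
      have "\<exists>u. u \<in> U z \<and> poly p u = poly p x" if "z \<in> Z" for z
        using imU[OF that] x by (metis imageE)
      then have "\<forall>z\<in>Z. \<exists>u. u \<in> U z \<and> poly p u = poly p x" by blast
      from bchoice[OF this] obtain u where u: "\<And>z. z \<in> Z \<Longrightarrow> u z \<in> U z \<and> poly p (u z) = poly p x"
        by blast
      have "inj_on u Z"
      proof (rule inj_onI, rule ccontr)
        fix z z' assume z: "z \<in> Z" "z' \<in> Z" "u z = u z'" "z \<noteq> z'"
        then have "u z \<in> U z \<inter> U z'" using u[of z] u[of z'] by simp
        then show False using disj z by blast
      qed
      then have "card (u ` Z) = degree p" using cardZ by (simp add: card_image)
      moreover have "u ` Z \<subseteq> {y. poly p y = poly p x}" using u by blast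
      ultimately have "u ` Z = {y. poly p y = poly p x}"
        using finite_poly_fibre[OF deg, of "poly p x"] by (metis card_seteq)
      then have "x \<in> u ` Z" by simp
      then obtain z where "z \<in> Z" "x = u z" by blast
      then show "x \<in> \<Union> (U ` Z)" using u[of z] by auto
    qed
  qed (auto simp: U_def)
  have "t \<in> poly p ` ball z (r z)" if "z \<in> Z" for z
    by (rule image_eqI[of _ _ z]) (use that r[OF that] in \<open>auto simp: Z_def\<close>)
  then have T: "t \<in> T" using t by (simp add: T_def)
  have "\<exists>q. homeomorphism (U z) T (poly p) q" if z: "z \<in> Z" for z
  proof -
    have "inj_on (poly p) (U z)"
      using r[OF z] unfolding U_def by (meson inf_le1 inj_on_subset)
    then obtain q where "homeomorphism (U z) (poly p ` U z) (poly p) q"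
      using invariance_of_domain_homeomorphism[OF openU[of z] cont order_refl] by blast
    then show ?thesis unfolding imU[OF z] by blast
  qed
  moreover have "pairwise disjnt (U ` Z)"
    using disj by (auto simp: pairwise_def disjnt_def)
  moreover have "poly p -` (- CV) \<inter> poly p -` T = poly p -` T" by (auto simp: T_def)
  moreover have "openin (top_of_set (poly p -` (- CV))) (U z)" for z
    by (rule open_subset) (use openU in \<open>auto simp: U_def T_def\<close>)
  moreover have "openin (top_of_set (- CV)) T"
    by (rule open_subset) (use \<open>open T\<close> in \<open>auto simp: T_def\<close>)
  ultimately show "\<exists>T. t \<in> T \<and> openin (top_of_set (- CV)) T \<and>
         (\<exists>v. \<Union> v = poly p -` (- CV) \<inter> poly p -` T \<and>
              (\<forall>u\<in>v. openin (top_of_set (poly p -` (- CV))) u) \<and>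
              pairwise disjnt v \<and> (\<forall>u\<in>v. \<exists>q. homeomorphism u T (poly p) q))"
    using T union by (intro exI[of _ T] conjI exI[of _ "U ` Z"]) simp_all
qed

text \<open>Continuity keeps g near \<open>g w0\<close>, where p is injective, so g is locally the
  holomorphic inverse of p composed with e.\<close>

lemma lift_of_poly_holomorphic:
  fixes p :: "complex poly"
  assumes "open S" and g: "continuous_on S g" and e: "e holomorphic_on S"
    and eq: "\<And>w. w \<in> S \<Longrightarrow> poly p (g w) = e w"
    and reg: "\<And>w. w \<in> S \<Longrightarrow> poly (pderiv p) (g w) \<noteq> 0"
  shows "g holomorphic_on S"
proof -
  have "g field_differentiable (at w0)" if w0: "w0 \<in> S" for w0
  proof -
    have "deriv (poly p) (g w0) \<noteq> 0"
      using reg[OF w0] by (simp add: DERIV_imp_deriv[OF poly_DERIV])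
    moreover have hol: "poly p holomorphic_on A" for A by (intro holomorphic_intros)
    ultimately obtain r where r: "r > 0" "inj_on (poly p) (ball (g w0) r)"
      using has_complex_derivative_locally_injective[of "poly p" UNIV "g w0"] by auto
    obtain q where q: "q holomorphic_on (poly p ` ball (g w0) r)"
        "\<And>z. z \<in> ball (g w0) r \<Longrightarrow> q (poly p z) = z"
      using holomorphic_has_inverse[OF hol open_ball r(2)] by metis
    have "open (poly p ` ball (g w0) r)"
      by (rule invariance_of_domain) (use r(2) in \<open>auto intro: continuous_intros\<close>)
    moreover have "e w0 \<in> poly p ` ball (g w0) r"
      using r(1) eq[OF w0] by (intro image_eqI[of _ _ "g w0"]) auto
    ultimately have "q field_differentiable at (e w0)"
      using q(1) holomorphic_on_imp_differentiable_at by blast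
    moreover have "e field_differentiable at w0"
      using e w0 \<open>open S\<close> holomorphic_on_imp_differentiable_at by blast
    ultimately have qe: "(q \<circ> e) field_differentiable at w0"
      using field_differentiable_compose by blast
    have "isCont g w0" using g w0 \<open>open S\<close> continuous_on_eq_continuous_at by blast
    then have lim: "(g \<longlongrightarrow> g w0) (nhds w0)"
      unfolding continuous_at tendsto_at_iff_tendsto_nhds .
    have "\<forall>\<^sub>F w in nhds w0. g w \<in> ball (g w0) r"
      by (rule topological_tendstoD[OF lim open_ball]) (use r(1) in simp)
    moreover have "\<forall>\<^sub>F w in nhds w0. w \<in> S" using \<open>open S\<close> w0 by (rule eventually_nhds_in_open)
    ultimately have ev: "\<forall>\<^sub>F w in nhds w0. g w = (q \<circ> e) w"
      by eventually_elim (metis q(2) eq comp_apply)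
    then show ?thesis
      using qe DERIV_cong_ev[OF refl ev refl] unfolding field_differentiable_def by blast
  qed
  then show ?thesis
    by (auto simp: holomorphic_on_def field_differentiable_at_within)
qed

text \<open>The branches are lifts of exp through the covering, labelled by their values K at the
  base point w0. Uniqueness of lifts makes distinct branches disjoint, and counting roots shows that
  they exhaust each fibre. The last clause says that any continuous solution on a connected subset
  is one of the branches; it later shows that a translation of w permutes them.\<close>

lemma exp_root_branches:
  fixes p :: "complex poly"
  assumes deg: "degree p > 0" and S: "open S" "simply_connected S" "w0 \<in> S"
    and reg: "\<And>w z. w \<in> S \<Longrightarrow> poly p z = exp w \<Longrightarrow> poly (pderiv p) z \<noteq> 0"
  obtains K :: "complex set" and g :: "complex \<Rightarrow> complex \<Rightarrow> complex"
    where "finite K" "\<And>k. k \<in> K \<Longrightarrow> g k holomorphic_on S"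
      "\<And>w. w \<in> S \<Longrightarrow> bij_betw (\<lambda>k. g k w) K {z. poly p z = exp w}"
      "\<And>h T. T \<subseteq> S \<Longrightarrow> connected T \<Longrightarrow> T \<noteq> {} \<Longrightarrow> continuous_on T h \<Longrightarrow> (\<And>w. w \<in> T \<Longrightarrow> poly p (h w) = exp w)
         \<Longrightarrow> \<exists>k\<in>K. \<forall>w\<in>T. h w = g k w"
proof -
  define CV where "CV = poly p ` {z. poly (pderiv p) z = 0}"
  have cov: "covering_space (poly p -` (- CV)) (poly p) (- CV)"
    unfolding CV_def by (rule covering_space_poly[OF deg])
  have notCV: "exp w \<in> - CV" if "w \<in> S" for w
    using reg[OF that] unfolding CV_def by force
  define K where "K = {z. poly p z = exp w0}"
  have finK: "finite K" unfolding K_def by (rule finite_poly_fibre[OF deg])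
  have lpc: "locally path_connected S" using S(1) by (rule open_imp_locally_path_connected)
  have "\<exists>g. continuous_on S g \<and> g \<in> S \<rightarrow> poly p -` (- CV) \<and> g w0 = k \<and> (\<forall>w\<in>S. poly p (g w) = exp w)"
    if "k \<in> K" for k
  proof -
    have k: "k \<in> poly p -` (- CV)" "exp w0 = poly p k"
      using that notCV[OF S(3)] by (auto simp: K_def)
    have "continuous_on S exp" by (intro continuous_intros)
    moreover have "exp \<in> S \<rightarrow> - CV" using notCV by blast
    ultimately show ?thesis
      by (rule covering_space_lift_strong[where f = exp and z = w0, OF cov k(1) S(3,2) lpc _ _ k(2)]) blast
  qed
  then obtain g where "\<And>k. k \<in> K \<Longrightarrow> continuous_on S (g k) \<and> g k \<in> S \<rightarrow> poly p -` (- CV) \<and>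
      g k w0 = k \<and> (\<forall>w\<in>S. poly p (g k w) = exp w)"
    by metis
  then have g: "\<And>k. k \<in> K \<Longrightarrow> continuous_on S (g k)" "\<And>k. k \<in> K \<Longrightarrow> g k w0 = k"
      "\<And>k w. k \<in> K \<Longrightarrow> w \<in> S \<Longrightarrow> poly p (g k w) = exp w"
    by blast+
  have unique: "h w = h' w" if h: "continuous_on T h" "\<And>w. w \<in> T \<Longrightarrow> poly p (h w) = exp w"
    and h': "continuous_on T h'" "\<And>w. w \<in> T \<Longrightarrow> poly p (h' w) = exp w"
    and T: "T \<subseteq> S" "connected T" "v \<in> T" "w \<in> T" "h v = h' v" for T h h' v w
  proof (rule covering_space_lift_unique[OF cov T(5) _ _ h(1) _ _ h'(1) _ _ T(2-4)])
    show "continuous_on T exp" by (intro continuous_intros)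
  qed (use T(1) h(2) h'(2) notCV in auto)
  have "connected S" using S(2) simply_connected_imp_connected by blast
  have bij: "bij_betw (\<lambda>k. g k w) K {z. poly p z = exp w}" if w: "w \<in> S" for w
  proof -
    have inj: "inj_on (\<lambda>k. g k w) K"
    proof (rule inj_onI)
      fix k l assume kl: "k \<in> K" "l \<in> K" "g k w = g l w"
      have "g k w0 = g l w0"
        by (rule unique[of S "g k" "g l" w]) (use kl g w S \<open>connected S\<close> in auto)
      then show "k = l" using g(2) kl by simp
    qed
    have "card {z. poly p z = exp w} = card K"
      unfolding K_def using poly_minus_const_decompose(2)[OF deg reg] w S(3) by simp
    moreover have "card ((\<lambda>k. g k w) ` K) = card K" using inj by (rule card_image)
    moreover have "(\<lambda>k. g k w) ` K \<subseteq> {z. poly p z = exp w}" using g(3) w by auto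
    ultimately have "(\<lambda>k. g k w) ` K = {z. poly p z = exp w}"
      using finite_poly_fibre(1)[OF deg] by (metis card_subset_eq)
    then show ?thesis using inj by (simp add: bij_betw_def)
  qed
  show ?thesis
  proof (rule that[of K g, OF finK])
    fix k assume k: "k \<in> K"
    show "g k holomorphic_on S"
      by (rule lift_of_poly_holomorphic[OF S(1) g(1)[OF k], of exp p])
         (use g(3)[OF k] reg in \<open>auto intro!: holomorphic_intros\<close>)
  next
    fix h T assume T: "T \<subseteq> S" "connected T" "T \<noteq> {}" "continuous_on T h" 
      and h: "\<And>w. w \<in> T \<Longrightarrow> poly p (h w) = exp w"
    obtain v where v: "v \<in> T" using T by blast
    then have "v \<in> S" using T(1) by blast
    then have "(\<lambda>k. g k v) ` K = {z. poly p z = exp v}"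
      by (rule bij_betw_imp_surj_on[OF bij])
    then have "h v \<in> (\<lambda>k. g k v) ` K" using h[OF v] by simp
    then obtain k where k: "k \<in> K" "h v = g k v" by blast
    have cont: "continuous_on T (g k)" using g(1)[OF k(1)] T(1) by (rule continuous_on_subset)
    have gk: "poly p (g k w) = exp w" if "w \<in> T" for w using that T(1) g(3)[OF k(1)] by blast
    have "h w = g k w" if "w \<in> T" for w
      by (rule unique[OF T(4) h cont gk T(1,2) v that k(2)])
    then show "\<exists>k\<in>K. \<forall>w\<in>T. h w = g k w" using k(1) by blast
  qed (rule bij)
qed

section \<open>Vanishing moments and Cauchy integrals\<close>

text \<open>Entire integrands have primitives, so the given path may be exchanged for the segment,
  on which all later integrals are taken.\<close>

lemma has_contour_integral_linepath_of_entire: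
  assumes "F holomorphic_on UNIV" "valid_path \<gamma>" "(F has_contour_integral I) \<gamma>"
  shows "(F has_contour_integral I) (linepath (pathstart \<gamma>) (pathfinish \<gamma>))"
proof -
  obtain G where G: "\<And>x. x \<in> UNIV \<Longrightarrow> (G has_field_derivative F x) (at x within UNIV)"
    using holomorphic_convex_primitive'[OF convex_UNIV open_UNIV assms(1)] by blast
  have "(F has_contour_integral (G (pathfinish \<gamma>) - G (pathstart \<gamma>))) \<gamma>"
    by (rule contour_integral_primitive[OF G assms(2)]) auto
  moreover have "(F has_contour_integral (G (pathfinish \<gamma>) - G (pathstart \<gamma>)))
      (linepath (pathstart \<gamma>) (pathfinish \<gamma>))"
    using contour_integral_primitive[OF G valid_path_linepath] by fastforce
  ultimately show ?thesis using assms(3) has_contour_integral_unique by blast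
qed

text \<open>The derivative of \<open>p ^ Suc i * f\<close> is a combination of both integrands, and
  its integral vanishes because p is zero at both endpoints.\<close>

lemma moments_by_parts:
  fixes p f :: "complex poly"
  assumes "poly p a = 0" "poly p b = 0"
    and moments: "\<And>i. ((\<lambda>z. poly p z ^ i * poly (pderiv f) z) has_contour_integral 0) (linepath a b)"
  shows "((\<lambda>z. poly p z ^ i * (poly f z * poly (pderiv p) z)) has_contour_integral 0) (linepath a b)"
proof -
  define G where "G = p ^ Suc i * f"
  have "((\<lambda>z. poly (pderiv G) z) has_contour_integral (poly G b - poly G a)) (linepath a b)"
    using contour_integral_primitive[of UNIV "poly G" "poly (pderiv G)" "linepath a b"]
    by (auto intro: poly_DERIV)
  then have "((\<lambda>z. poly (pderiv G) z) has_contour_integral 0) (linepath a b)"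
    using assms(1,2) by (simp add: G_def)
  from has_contour_integral_diff[OF this moments[of "Suc i"]]
  have "((\<lambda>z. of_nat (Suc i) * (poly p z ^ i * (poly f z * poly (pderiv p) z))) has_contour_integral 0) (linepath a b)"
    by (simp add: G_def pderiv_mult pderiv_power_Suc algebra_simps del: of_nat_Suc power_Suc)
  from has_contour_integral_lmul[OF this, of "inverse (of_nat (Suc i))"]
  show ?thesis by (simp add: field_simps del: of_nat_Suc)
qed

text \<open>Multiplying the integrand by \<open>u / t\<close> does not change the integral, but makes it arbitrarily small.\<close>

lemma Cauchy_transform_eq_0:
  assumes cont: "continuous_on (closed_segment a b) F" "continuous_on (closed_segment a b) u"
    and moments: "\<And>i. ((\<lambda>z. u z ^ i * F z) has_contour_integral 0) (linepath a b)"
    and M: "\<And>z. z \<in> closed_segment a b \<Longrightarrow> norm (u z) \<le> M" "M < norm t"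
  shows "((\<lambda>z. F z / (u z - t)) has_contour_integral 0) (linepath a b)"
proof -
  have "0 \<le> M" using M(1)[of a] norm_ge_zero[of "u a"] by (meson ends_in_segment(1) order_trans)
  then have t: "t \<noteq> 0" using M(2) by auto
  have ut: "u z \<noteq> t" if "z \<in> closed_segment a b" for z using M(1)[OF that] M(2) by auto
  have contH: "continuous_on (closed_segment a b) (\<lambda>z. F z / (u z - t))"
    using ut by (intro continuous_intros cont) auto
  then obtain I where I: "((\<lambda>z. F z / (u z - t)) has_contour_integral I) (linepath a b)"
    using contour_integrable_continuous_linepath contour_integrable_on_def by blast
  have step: "((\<lambda>z. (u z / t) ^ m * (F z / (u z - t))) has_contour_integral I) (linepath a b)" for m
  proof (induction m)
    case (Suc m)
    have "((\<lambda>z. (u z / t) ^ m * (F z / (u z - t)) + (1 / t ^ Suc m) * (u z ^ m * F z))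
        has_contour_integral I + (1 / t ^ Suc m) * 0) (linepath a b)"
      by (intro has_contour_integral_add has_contour_integral_lmul Suc moments)
    then have sum: "((\<lambda>z. (u z / t) ^ m * (F z / (u z - t)) + (1 / t ^ Suc m) * (u z ^ m * F z))
        has_contour_integral I) (linepath a b)"
      by (simp only: mult_zero_right add_0_right)
    show ?case
    proof (rule has_contour_integral_eq[OF sum])
      fix z assume "z \<in> path_image (linepath a b)"
      then have nz: "u z - t \<noteq> 0" using ut by simp
      \<comment> \<open>Here Q, T, D stand for the power of u, the power of t and u - t; the
        identity rests on 1 / D + 1 / t = (D + t) / (t D).\<close>
      have "Q / T * (F z / D) + (1 / (t * T)) * (Q * F z) = ((D + t) * Q) / (t * T) * (F z / D)"
        if "D \<noteq> 0" "T \<noteq> 0" for D T Q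
        using that t by (simp add: add_divide_distrib ring_distribs)
      from this[OF nz power_not_zero[OF t, of m], of "u z ^ m"]
      show "(u z / t) ^ m * (F z / (u z - t)) + (1 / t ^ Suc m) * (u z ^ m * F z)
          = (u z / t) ^ Suc m * (F z / (u z - t))"
        unfolding power_divide power_Suc diff_add_cancel times_divide_times_eq .
    qed
  qed (use I in simp)
  obtain C' where C': "\<And>y. y \<in> (\<lambda>z. F z / (u z - t)) ` closed_segment a b \<Longrightarrow> norm y \<le> C'"
    using compact_imp_bounded[OF compact_continuous_image[OF contH compact_segment]]
    unfolding bounded_iff by blast
  define C where "C = max C' 0"
  have "C \<ge> 0" by (simp add: C_def)
  have C: "norm (F z / (u z - t)) \<le> C" if "z \<in> closed_segment a b" for z
    using C'[OF imageI[OF that]] unfolding C_def by (rule max.coboundedI1)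
  have bound: "norm I \<le> (M / norm t) ^ m * C * norm (b - a)" for m
  proof (rule has_contour_integral_bound_linepath[OF step])
    show "0 \<le> (M / norm t) ^ m * C" using \<open>0 \<le> C\<close> \<open>0 \<le> M\<close> by simp
    fix z assume z: "z \<in> closed_segment a b"
    have "norm ((u z / t) ^ m) \<le> (M / norm t) ^ m"
      unfolding norm_power norm_divide using M(1)[OF z] by (intro power_mono divide_right_mono) auto
    then show "norm ((u z / t) ^ m * (F z / (u z - t))) \<le> (M / norm t) ^ m * C"
      unfolding norm_mult using C[OF z] \<open>0 \<le> M\<close> by (intro mult_mono) auto
  qed
  have "(\<lambda>m. (M / norm t) ^ m * C * norm (b - a)) \<longlonglongrightarrow> 0 * C * norm (b - a)"
    using \<open>0 \<le> M\<close> M(2) by (intro tendsto_intros LIMSEQ_power_zero) (auto simp: t)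
  then have "norm I \<le> 0 * C * norm (b - a)"
    by (rule LIMSEQ_le_const) (use bound in blast)
  then show ?thesis using I by simp
qed

section \<open>Partial fractions under the integral sign\<close>

text \<open>\<open>synthetic_div f y\<close> is the quotient (f(z) - f(y)) / (z - y), whose integral
  depends on y as an entire function. The factor \<open>z ^ m\<close> generalises the claim for the
  induction, since adding a coefficient to f multiplies the old quotient by z.\<close>

lemma synthetic_div_contour_integral:
  fixes f :: "complex poly"
  shows "\<exists>E. E holomorphic_on UNIV \<and>
    (\<forall>y. ((\<lambda>z. z ^ m * poly (synthetic_div f y) z) has_contour_integral E y) (linepath a b))"
proof (induction f arbitrary: m)
  case 0
  then show ?case by (intro exI[of _ "\<lambda>_. 0"]) (auto intro: has_contour_integral_0)
next
  case (pCons c f)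
  obtain E where E: "E holomorphic_on UNIV"
    "\<And>y. ((\<lambda>z. z ^ Suc m * poly (synthetic_div f y) z) has_contour_integral E y) (linepath a b)"
    using pCons.IH by blast
  have "(\<lambda>z. z ^ m) contour_integrable_on linepath a b"
    by (intro contour_integrable_continuous_linepath continuous_intros)
  then obtain I where I: "((\<lambda>z. z ^ m) has_contour_integral I) (linepath a b)"
    unfolding contour_integrable_on_def by blast
  have "((\<lambda>z. z ^ m * poly (synthetic_div (pCons c f) y) z) has_contour_integral
      poly f y * I + E y) (linepath a b)" for y
    using has_contour_integral_add[OF has_contour_integral_lmul[OF I, of "poly f y"] E(2)[of y]]
    by (simp add: algebra_simps)
  moreover have "(\<lambda>y. poly f y * I + E y) holomorphic_on UNIV"
    by (intro holomorphic_intros E(1))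
  ultimately show ?case by blast
qed

text \<open>The integrand splits as (f(z) - f(r)) / (z - r) + f(r) / (z - r). The first part
  contributes the entire function E; for the second, Ln (1 - z / r) is a primitive on the disc of
  radius |r|, which contains the segment. Only the logarithms restrict r, so only they need care in
  the continuation.\<close>

lemma contour_integral_partial_fraction:
  fixes f :: "complex poly"
  obtains E where "E holomorphic_on UNIV"
    "\<And>r. norm a < norm r \<Longrightarrow> norm b < norm r \<Longrightarrow>
      ((\<lambda>z. poly f z / (z - r)) has_contour_integral
        E r + poly f r * (Ln (1 - b / r) - Ln (1 - a / r))) (linepath a b)"
proof -
  obtain E where E: "E holomorphic_on UNIV"
    "\<And>y. ((\<lambda>z. poly (synthetic_div f y) z) has_contour_integral E y) (linepath a b)"
    using synthetic_div_contour_integral[of 0 f a b] by auto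
  have "((\<lambda>z. poly f z / (z - r)) has_contour_integral
        E r + poly f r * (Ln (1 - b / r) - Ln (1 - a / r))) (linepath a b)"
    if r: "norm a < norm r" "norm b < norm r" for r
  proof -
    have r0: "r \<noteq> 0" using r(1) norm_ge_zero[of a] by auto
    have seg: "closed_segment a b \<subseteq> ball 0 (norm r)"
      using r by (intro closed_segment_subset) auto
    have "((\<lambda>z. Ln (1 - z / r)) has_field_derivative 1 / (z - r)) (at z within ball 0 (norm r))"
      if z: "z \<in> ball 0 (norm r)" for z
    proof -
      have "norm (z / r) < 1" using z r0 by (simp add: norm_divide)
      then have "Re (z / r) < 1" using complex_Re_le_cmod[of "z / r"] by linarith
      then have "1 - z / r \<notin> \<real>\<^sub>\<le>\<^sub>0" by (auto simp: complex_nonpos_Reals_iff)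
      moreover have "z - r \<noteq> 0" using z by auto
      ultimately show ?thesis using r0
        by (auto intro!: derivative_eq_intros simp: divide_simps)
    qed
    from contour_integral_primitive[OF this valid_path_linepath, of a b]
    have "((\<lambda>z. 1 / (z - r)) has_contour_integral Ln (1 - b / r) - Ln (1 - a / r)) (linepath a b)"
      using seg by auto
    from has_contour_integral_add[OF E(2) has_contour_integral_lmul[OF this, of "poly f r"]]
    show ?thesis
    proof (rule has_contour_integral_eq)
      fix z assume "z \<in> path_image (linepath a b)"
      then have "z - r \<noteq> 0" using seg by auto
      moreover have "poly f z = (z - r) * poly (synthetic_div f r) z + poly f r"
        by (subst (1) synthetic_div_correct'[of r f, symmetric]) (simp add: algebra_simps)
      ultimately show "poly (synthetic_div f r) z + poly f r * (1 / (z - r)) = poly f z / (z - r)"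
        by (simp add: add_divide_distrib)
    qed
  qed
  with E(1) show ?thesis using that by blast
qed

lemma pderiv_quotient_partial_fractions:
  fixes p :: "complex poly"
  assumes "finite K" and p: "p - [:t:] = smult c (\<Prod>k\<in>K. [:- r k, 1:])" and z: "poly p z \<noteq> t"
  shows "poly (pderiv p) z / (poly p z - t) = (\<Sum>k\<in>K. 1 / (z - r k))"
proof -
  have pz: "poly p z - t = c * (\<Prod>k\<in>K. z - r k)"
    using arg_cong[OF p, of "\<lambda>q. poly q z"] by (simp add: poly_prod algebra_simps)
  have "pderiv p = smult c (\<Sum>k\<in>K. \<Prod>j\<in>K - {k}. [:- r j, 1:])"
    using arg_cong[OF p, of pderiv]
    by (simp add: pderiv_diff pderiv_smult pderiv_prod pderiv_pCons)
  then have "poly (pderiv p) z = c * (\<Sum>k\<in>K. \<Prod>j\<in>K - {k}. z - r j)"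
    by (simp add: poly_sum poly_prod algebra_simps)
  also have "\<dots> = (poly p z - t) * (\<Sum>k\<in>K. 1 / (z - r k))"
    unfolding pz sum_distrib_left mult.assoc
  proof (intro sum.cong refl)
    fix k assume "k \<in> K"
    then have "(\<Prod>k\<in>K. z - r k) = (z - r k) * (\<Prod>j\<in>K - {k}. z - r j)"
      using \<open>finite K\<close> by (simp add: prod.remove)
    moreover have "(\<Prod>k\<in>K. z - r k) \<noteq> 0" using pz z by auto
    then have "z - r k \<noteq> 0" using \<open>k \<in> K\<close> \<open>finite K\<close> by (meson prod_zero_iff)
    ultimately show "c * (\<Prod>j\<in>K - {k}. z - r j) = c * ((\<Prod>k\<in>K. z - r k) * (1 / (z - r k)))"
      by simp
  qed
  finally show ?thesis using z by simp
qed

section \<open>Logarithms and limits of root branches\<close>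

text \<open>Two continuous logarithms of the same function on a connected set differ by a constant,
  by uniqueness of lifts through exp.\<close>

lemma exp_eq_imp_increment_eq:
  fixes f g :: "complex \<Rightarrow> complex"
  assumes "connected T" "continuous_on T f" "continuous_on T g"
    and eq: "\<And>w. w \<in> T \<Longrightarrow> exp (f w) = exp (g w)" and w: "w \<in> T" "w' \<in> T"
  shows "f w' - f w = g w' - g w"
proof -
  have exp1: "exp (f w - g w) = 1" using eq[OF w(1)] by (simp add: exp_diff)
  have "f w' = g w' + (f w - g w)"
  proof (rule covering_space_lift_unique[OF covering_space_exp_punctured_plane,
        of f w "\<lambda>x. g x + (f w - g w)" T "\<lambda>x. exp (f x)"])
    show "exp (f x) = exp (g x + (f w - g w))" if "x \<in> T" for x
      using eq[OF that] exp1 by (simp add: exp_add)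
  qed (use assms in \<open>auto intro!: continuous_intros\<close>)
  then show ?thesis by simp
qed

text \<open>The curve u stays in a disc where c is the only possible zero of p, and takes equal
  values at w and w'. If a is not c, then z - a has a logarithm on the disc, so L returns to its
  value as well. If a = c, write p = (z - a)^d h with h free of zeros there: log h returns, and d L
  takes up the whole increment w' - w.\<close>

lemma log_increment_at_root:
  fixes p :: "complex poly"
  assumes T: "connected T" "w \<in> T" "w' \<in> T"
    and u: "continuous_on T u" "\<And>x. x \<in> T \<Longrightarrow> u x \<in> ball c \<epsilon>" "\<And>x. x \<in> T \<Longrightarrow> poly p (u x) = exp x" "u w' = u w"
    and L: "continuous_on T L" "\<And>x. x \<in> T \<Longrightarrow> exp (L x) = u x - a"
    and roots: "\<And>z. z \<in> ball c \<epsilon> \<Longrightarrow> poly p z = 0 \<Longrightarrow> z = c" and a: "poly p a = 0" and "p \<noteq> 0"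
  shows "a \<noteq> c \<Longrightarrow> L w' = L w" and "a = c \<Longrightarrow> of_nat (order a p) * (L w' - L w) = w' - w"
proof -
  have log: "\<exists>l. l holomorphic_on ball c \<epsilon> \<and> (\<forall>z\<in>ball c \<epsilon>. exp (l z) = poly q z)"
    if "\<And>z. z \<in> ball c \<epsilon> \<Longrightarrow> poly q z \<noteq> 0" for q
  proof -
    have "poly q holomorphic_on ball c \<epsilon>" by (intro holomorphic_intros)
    from contractible_imp_holomorphic_log[OF this] that show ?thesis
      by (metis convex_ball convex_imp_contractible)
  qed
  have cont: "continuous_on T (\<lambda>x. l (u x))" if "l holomorphic_on ball c \<epsilon>" for l
    by (rule continuous_on_compose2[OF holomorphic_on_imp_continuous_on[OF that] u(1)]) (use u(2) in blast)
  show "L w' = L w" if "a \<noteq> c"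
  proof -
    have "poly [:-a, 1:] z \<noteq> 0" if "z \<in> ball c \<epsilon>" for z
      using roots[OF that] a \<open>a \<noteq> c\<close> by auto
    then obtain l where l: "l holomorphic_on ball c \<epsilon>" "\<forall>z\<in>ball c \<epsilon>. exp (l z) = poly [:-a, 1:] z"
      using log by blast
    have "L w' - L w = l (u w') - l (u w)"
      by (rule exp_eq_imp_increment_eq[OF T(1) L(1) cont[OF l(1)] _ T(2,3)]) (use l(2) L(2) u(2) in auto)
    then show ?thesis using u(4) by simp
  qed
  show "of_nat (order a p) * (L w' - L w) = w' - w" if "a = c"
  proof -
    define d where "d = order a p"
    obtain h where h: "p = [:-a, 1:] ^ d * h" "\<not> [:-a, 1:] dvd h"
      using order_decomp[OF \<open>p \<noteq> 0\<close>] unfolding d_def by blast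
    have "poly h z \<noteq> 0" if "z \<in> ball c \<epsilon>" for z
    proof
      assume hz: "poly h z = 0"
      then have "poly p z = 0" by (subst h(1)) simp
      then show False using roots[OF that] h(2) hz \<open>a = c\<close> by (simp add: poly_eq_0_iff_dvd)
    qed
    then obtain l where l: "l holomorphic_on ball c \<epsilon>" "\<forall>z\<in>ball c \<epsilon>. exp (l z) = poly h z"
      using log by blast
    \<comment> \<open>Both \<open>d L + l \<circ> u\<close> and the identity are logarithms of \<open>p \<circ> u = exp\<close>.\<close>
    have "(of_nat d * L w' + l (u w')) - (of_nat d * L w + l (u w)) = w' - w"
    proof (rule exp_eq_imp_increment_eq[OF T(1) _ _ _ T(2,3), where g = "\<lambda>x. x"])
      show "continuous_on T (\<lambda>x. of_nat d * L x + l (u x))" by (intro continuous_intros L cont l)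
      fix x assume x: "x \<in> T"
      have "exp (of_nat d * L x + l (u x)) = (u x - a) ^ d * poly h (u x)"
        using x L(2) l(2) u(2) by (simp add: exp_add exp_of_nat_mult)
      also have "\<dots> = poly p (u x)" by (subst h(1)) simp
      finally show "exp (of_nat d * L x + l (u x)) = exp x" using u(3)[OF x] by simp
    qed (intro continuous_intros)
    then show ?thesis using u(4) by (simp add: d_def algebra_simps)
  qed
qed

section \<open>Limits of root branches at the zeros of p\<close>

lemma norm_poly_ge_off_roots:
  fixes p :: "complex poly"
  assumes "\<epsilon> \<ge> 0" and far: "\<And>c. poly p c = 0 \<Longrightarrow> \<epsilon> \<le> dist c z"
  shows "norm (lead_coeff p) * \<epsilon> ^ degree p \<le> norm (poly p z)"
proof (cases "p = 0")
  case False
  obtain root where root: "smult (lead_coeff p) (\<Prod>i<degree p. [:-root i, 1:]) = p"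
    using complex_poly_decompose' by metis
  have eq: "poly p x = lead_coeff p * (\<Prod>i<degree p. x - root i)" for x
    using arg_cong[OF root, of "\<lambda>q. poly q x"] by (simp add: poly_prod)
  have "\<epsilon> ^ degree p = (\<Prod>i<degree p. \<epsilon>)" by simp
  also have "\<dots> \<le> (\<Prod>i<degree p. norm (z - root i))"
  proof (intro prod_mono conjI)
    fix i assume "i \<in> {..<degree p}"
    then have "poly p (root i) = 0" by (auto simp: eq)
    then show "\<epsilon> \<le> norm (z - root i)" using far by (metis dist_commute dist_norm)
  qed (use \<open>\<epsilon> \<ge> 0\<close> in simp)
  finally show ?thesis by (simp add: eq[of z] norm_mult prod_norm mult_left_mono)
qed simp

text \<open>Small values of p force u into the union of the discs around the zeros; the discs are
  disjoint and the image of T is connected, so a single disc contains it.\<close>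

lemma lift_clusters_at_root:
  fixes p :: "complex poly"
  assumes "p \<noteq> 0" and "\<epsilon> \<ge> 0"
    and sep: "\<And>c c'. poly p c = 0 \<Longrightarrow> poly p c' = 0 \<Longrightarrow> c \<noteq> c' \<Longrightarrow> ball c \<epsilon> \<inter> ball c' \<epsilon> = {}"
    and T: "connected T" "T \<noteq> {}" "continuous_on T u"
    and small: "\<And>x. x \<in> T \<Longrightarrow> norm (poly p (u x)) < norm (lead_coeff p) * \<epsilon> ^ degree p"
  shows "\<exists>c. poly p c = 0 \<and> (\<forall>x\<in>T. u x \<in> ball c \<epsilon>)"
proof -
  have near: "\<exists>c. poly p c = 0 \<and> u x \<in> ball c \<epsilon>" if "x \<in> T" for x
    using norm_poly_ge_off_roots[OF \<open>\<epsilon> \<ge> 0\<close>, of p "u x"] small[OF that] by (force simp: not_less)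
  obtain x0 c where x0: "x0 \<in> T" "poly p c = 0" "u x0 \<in> ball c \<epsilon>" using T(2) near by blast
  define V where "V = \<Union> ((\<lambda>c. ball c \<epsilon>) ` ({c. poly p c = 0} - {c}))"
  have "connected (u ` T)" using T connected_continuous_image by blast
  moreover have "open (ball c \<epsilon>)" "open V" by (auto simp: V_def)
  moreover have "u ` T \<subseteq> ball c \<epsilon> \<union> V" using near unfolding V_def by blast
  moreover have "ball c \<epsilon> \<inter> V = {}" using sep x0(2) unfolding V_def by blast
  moreover have "ball c \<epsilon> \<inter> u ` T \<noteq> {}" using x0 by blast
  ultimately have "V \<inter> u ` T = {}" using connectedD[of "u ` T" "ball c \<epsilon>" V] by blast
  then have "\<forall>x\<in>T. u x \<in> ball c \<epsilon>" using \<open>u ` T \<subseteq> _\<close> by blast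
  then show ?thesis using x0(2) by blast
qed

text \<open>As p(r m) shrinks, r m comes within any e' of some zero, and disjointness of the discs
  identifies that zero as c.\<close>

lemma lift_tendsto_root:
  fixes p :: "complex poly"
  assumes "p \<noteq> 0" "\<epsilon> > 0"
    and sep: "\<And>c c'. poly p c = 0 \<Longrightarrow> poly p c' = 0 \<Longrightarrow> c \<noteq> c' \<Longrightarrow> ball c \<epsilon> \<inter> ball c' \<epsilon> = {}"
    and c: "poly p c = 0" "\<And>m. r m \<in> ball c \<epsilon>" and lim: "(\<lambda>m. poly p (r m)) \<longlonglongrightarrow> 0"
  shows "r \<longlonglongrightarrow> c"
proof (rule metric_LIMSEQ_I)
  fix e :: real assume "e > 0"
  define e' where "e' = min e \<epsilon>"
  have e': "e' > 0" "e' \<le> e" "e' \<le> \<epsilon>" using \<open>e > 0\<close> \<open>\<epsilon> > 0\<close> by (auto simp: e'_def)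
  have "norm (lead_coeff p) * e' ^ degree p > 0" using e'(1) \<open>p \<noteq> 0\<close> by simp
  from LIMSEQ_D[OF lim this] obtain N
    where N: "\<And>m. m \<ge> N \<Longrightarrow> norm (poly p (r m)) < norm (lead_coeff p) * e' ^ degree p" by auto
  have "dist (r m) c < e" if m: "m \<ge> N" for m
  proof -
    obtain c' where c': "poly p c' = 0" "dist c' (r m) < e'"
      using norm_poly_ge_off_roots[of e' p "r m"] N[OF m] e'(1) by (force simp: not_less)
    then have "r m \<in> ball c' \<epsilon> \<inter> ball c \<epsilon>" using c(2) e' by simp
    then have "c' = c" using sep c'(1) c(1) by blast
    then show ?thesis using c' e' by (simp add: dist_commute)
  qed
  then show "\<exists>N. \<forall>m\<ge>N. dist (r m) c < e" by blast
qed

text \<open>Letting m tend to infinity in the factorisation of p - \<tau> m gives p as the product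
  over the limits c k, so a zero is counted once for each root sequence tending to it.\<close>

lemma order_eq_card_limits:
  fixes p :: "complex poly"
  assumes "finite K" "p \<noteq> 0"
    and eq: "\<And>m. p - [:\<tau> m:] = smult (lead_coeff p) (\<Prod>k\<in>K. [:- r k m, 1:])"
    and \<tau>: "\<tau> \<longlonglongrightarrow> 0" and r: "\<And>k. k \<in> K \<Longrightarrow> r k \<longlonglongrightarrow> c k"
  shows "order a p = card {k\<in>K. c k = a}"
proof -
  have "poly p z = poly (smult (lead_coeff p) (\<Prod>k\<in>K. [:- c k, 1:])) z" for z
  proof -
    have "(\<lambda>m. poly p z - \<tau> m) \<longlonglongrightarrow> poly p z - 0" by (intro tendsto_intros \<tau>)
    moreover have "poly p z - \<tau> m = lead_coeff p * (\<Prod>k\<in>K. z - r k m)" for m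
      using arg_cong[OF eq[of m], of "\<lambda>q. poly q z"] by (simp add: poly_prod)
    ultimately have "(\<lambda>m. lead_coeff p * (\<Prod>k\<in>K. z - r k m)) \<longlonglongrightarrow> poly p z" by simp
    moreover have "(\<lambda>m. lead_coeff p * (\<Prod>k\<in>K. z - r k m)) \<longlonglongrightarrow> lead_coeff p * (\<Prod>k\<in>K. z - c k)"
      by (intro tendsto_intros tendsto_prod r)
    ultimately show ?thesis using LIMSEQ_unique by (fastforce simp: poly_prod)
  qed
  then have p: "p = smult (lead_coeff p) (\<Prod>k\<in>K. [:- c k, 1:])"
    by (simp add: poly_eq_poly_eq_iff[symmetric] fun_eq_iff)
  have "proots p = (\<Sum>k\<in>K. {#c k#})"
    by (subst p, subst proots_smult) (use \<open>p \<noteq> 0\<close> in \<open>auto simp: proots_prod\<close>)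
  then have "count (proots p) a = (\<Sum>k\<in>K. count {#c k#} a)" by (simp add: count_sum)
  also have "\<dots> = (\<Sum>k\<in>K. if c k = a then 1 else 0)" by (intro sum.cong) auto
  also have "\<dots> = card {k\<in>K. c k = a}" using \<open>finite K\<close> by (simp add: sum.If_cases Int_def)
  finally show ?thesis using \<open>p \<noteq> 0\<close> by simp
qed

section \<open>A Vandermonde argument\<close>

text \<open>Vandermonde in Lagrange form: a polynomial q of degree below n that vanishes at every
  value of x except v turns the moment relations into q(v) times the fibre sum.\<close>

lemma moments_eq_0_imp_fibre_sum_eq_0:
  fixes c x :: "'k \<Rightarrow> 'a::field"
  assumes "finite K" "card (x ` K) \<le> n"
    and moments: "\<And>j. j < n \<Longrightarrow> (\<Sum>k\<in>K. c k * x k ^ j) = 0"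
  shows "(\<Sum>k | k \<in> K \<and> x k = v. c k) = 0"
proof (cases "v \<in> x ` K")
  case True
  define q where "q = (\<Prod>u\<in>x ` K - {v}. [:- u, 1:])"
  have deg: "degree q < n"
  proof -
    have "degree q = card (x ` K - {v})" unfolding q_def by (simp add: degree_prod_sum_eq)
    also have "\<dots> < card (x ` K)" using True \<open>finite K\<close> by (intro psubset_card_mono) auto
    finally show ?thesis using assms(2) by simp
  qed
  have "(\<Sum>k\<in>K. c k * poly q (x k)) = (\<Sum>j\<le>degree q. coeff q j * (\<Sum>k\<in>K. c k * x k ^ j))"
    unfolding poly_altdef sum_distrib_left by (subst sum.swap) (simp add: algebra_simps)
  also have "\<dots> = 0" using moments deg by simp
  also have "(\<Sum>k\<in>K. c k * poly q (x k)) = (\<Sum>k\<in>K. if x k = v then c k * poly q v else 0)"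
    by (intro sum.cong) (use \<open>finite K\<close> in \<open>auto simp: q_def poly_prod\<close>)
  also have "\<dots> = (\<Sum>k | k \<in> K \<and> x k = v. c k) * poly q v"
    using \<open>finite K\<close> by (simp add: sum.If_cases Int_def sum_distrib_right conj_commute)
  finally show ?thesis using \<open>finite K\<close> by (auto simp: q_def poly_prod)
next
  case False
  then show ?thesis by (intro sum.neutral) auto
qed

section \<open>Continuation of the moment relation\<close>

text \<open>In the coordinate w = log t, the domain joins a half plane, where |t| is below every
  nonzero critical value, to a thin horizontal strip at an angle \<theta> avoiding the arguments of
  the critical values. The strip reaches any prescribed real part B, and the union is star-shaped
  about a point of the intersection.\<close>

lemma slit_strip_domain:
  fixes CV :: "complex set" and B :: real
  assumes "finite CV"
  obtains S M w1 where "open S" "simply_connected S" "{w. Re w < - M} \<subseteq> S" "w1 \<in> S" "Re w1 = B"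
    "\<And>w. w \<in> S \<Longrightarrow> exp w \<notin> CV"
proof -
  have "open ({-pi<..<pi} - Arg ` CV)"
    using assms by (intro open_Diff finite_imp_closed) auto
  moreover have "infinite ({-pi<..<pi} - Arg ` CV)"
    using assms by (intro Diff_infinite_finite) (auto simp: infinite_Ioo)
  then have "{-pi<..<pi} - Arg ` CV \<noteq> {}" by (metis finite.emptyI)
  then obtain \<theta> where "\<theta> \<in> {-pi<..<pi} - Arg ` CV" by blast
  ultimately obtain e where e: "e > 0" "ball \<theta> e \<subseteq> {-pi<..<pi} - Arg ` CV"
    unfolding open_contains_ball by blast
  obtain \<delta> where \<delta>: "\<delta> > 0" "\<And>v. v \<in> CV \<Longrightarrow> v \<noteq> 0 \<Longrightarrow> \<delta> \<le> dist 0 v"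
    using finite_set_avoid[OF assms, of 0] by metis
  \<comment> \<open>For Re w < -M the value exp w has modulus below \<delta>; being nonzero, it
    cannot lie in \<open>CV\<close>.\<close>
  define M where "M = - ln \<delta>"
  define H where "H = {w. Re w < - M}"
  define T where "T = {w. \<theta> - e < Im w} \<inter> {w. Im w < \<theta> + e}"
  define w0 where "w0 = Complex (- M - 1) \<theta>"
  have open_HT: "open H" "open T"
    unfolding H_def T_def by (auto intro: open_halfspace_Re_lt open_halfspace_Im_lt open_halfspace_Im_gt)
  have convex_HT: "convex H" "convex T"
    unfolding H_def T_def
    by (auto intro: convex_halfspace_Re_lt convex_Int convex_halfspace_Im_lt convex_halfspace_Im_gt)
  have w0: "w0 \<in> H" "w0 \<in> T" using e(1) by (auto simp: w0_def H_def T_def)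
  have "starlike (H \<union> T)" unfolding starlike_def
  proof (intro bexI[of _ w0] ballI)
    fix x assume "x \<in> H \<union> T"
    then show "closed_segment w0 x \<subseteq> H \<union> T"
      using closed_segment_subset[OF w0(1) _ convex_HT(1)] closed_segment_subset[OF w0(2) _ convex_HT(2)]
      by blast
  qed (use w0 in blast)
  then have "simply_connected (H \<union> T)" by (rule starlike_imp_simply_connected)
  moreover have "Complex B \<theta> \<in> H \<union> T" using e(1) by (simp add: T_def)
  moreover have "exp w \<notin> CV" if "w \<in> H \<union> T" for w
  proof
    assume w: "exp w \<in> CV"
    consider "w \<in> H" | "w \<in> T" using \<open>w \<in> H \<union> T\<close> by blast
    then show False
    proof cases
      case 1
      then have "exp (Re w) < exp (ln \<delta>)" by (simp add: H_def M_def)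
      then show False using \<delta>(2)[OF w] \<delta>(1) by simp
    next
      case 2
      then have "Im w \<in> ball \<theta> e" by (auto simp: T_def dist_real_def)
      then have Im: "Im w \<in> {-pi<..<pi} - Arg ` CV" using e(2) by blast
      then have "Arg (exp w) = Im w" by (intro Arg_exp) auto
      then show False using w Im by (metis DiffD2 imageI)
    qed
  qed
  ultimately show ?thesis
    using that[of "H \<union> T" M "Complex B \<theta>"] open_HT by (auto simp: H_def)
qed

section \<open>The fibre identity for large t and its analytic continuation\<close>

lemma branches_decompose:
  fixes p :: "complex poly"
  assumes "degree p > 0" and reg: "\<And>z. poly p z = t \<Longrightarrow> poly (pderiv p) z \<noteq> 0"
    and bij: "bij_betw r K {z. poly p z = t}"
  shows "p - [:t:] = smult (lead_coeff p) (\<Prod>k\<in>K. [:- r k, 1:])"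
  using poly_minus_const_decompose(1)[OF assms(1) reg]
    prod.reindex_bij_betw[OF bij, of "\<lambda>z. [:- z, 1:]"] by simp

lemma poly_norm_attains_sup:
  fixes p :: "complex poly"
  assumes "R \<ge> 0"
  obtains z0 where "z0 \<in> cball 0 R" "\<And>z. z \<in> cball 0 R \<Longrightarrow> norm (poly p z) \<le> norm (poly p z0)"
proof -
  have "cball (0::complex) R \<noteq> {}" using assms by simp
  moreover have "continuous_on (cball 0 R) (\<lambda>z. norm (poly p z))" by (intro continuous_intros)
  ultimately show ?thesis using continuous_attains_sup[OF compact_cball] that by metis
qed

text \<open>When |t| exceeds |p| on the disc of radius R, all roots of p = t lie outside it. The
  integral of f p' / (p - t) is then zero by the Cauchy transform, and it equals the sum over the
  roots of the integrals of f / (z - r k).\<close>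

lemma moment_vanishing_fibre_identity:
  fixes p f :: "complex poly"
  assumes "poly p a = 0" "poly p b = 0"
    and moments: "\<And>i. ((\<lambda>z. poly p z ^ i * poly (pderiv f) z) has_contour_integral 0) (linepath a b)"
    and R: "norm a < R" "norm b < R"
    and E: "\<And>r. norm a < norm r \<Longrightarrow> norm b < norm r \<Longrightarrow> ((\<lambda>z. poly f z / (z - r)) has_contour_integral
        E r + poly f r * (Ln (1 - b / r) - Ln (1 - a / r))) (linepath a b)"
    and "finite K" and p: "p - [:t:] = smult (lead_coeff p) (\<Prod>k\<in>K. [:- r k, 1:])"
    and t: "\<And>z. z \<in> cball 0 R \<Longrightarrow> norm (poly p z) < norm t"
  shows "(\<Sum>k\<in>K. E (r k) + poly f (r k) * (Ln (1 - b / r k) - Ln (1 - a / r k))) = 0"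
proof -
  have seg: "closed_segment a b \<subseteq> cball 0 R" using R by (intro closed_segment_subset) auto
  have "R \<ge> 0" using R(1) norm_ge_zero[of a] by linarith
  then obtain z0 where z0: "z0 \<in> cball 0 R" "\<And>z. z \<in> cball 0 R \<Longrightarrow> norm (poly p z) \<le> norm (poly p z0)"
    by (rule poly_norm_attains_sup[of R p]) blast
  have root: "norm (r k) > R" if "k \<in> K" for k
  proof -
    have "poly p (r k) - t = 0"
      using arg_cong[OF p, of "\<lambda>q. poly q (r k)"] that \<open>finite K\<close> by (auto simp: poly_prod)
    then show ?thesis using t[of "r k"] by (force simp: not_less)
  qed
  have "((\<lambda>z. poly f z * poly (pderiv p) z / (poly p z - t)) has_contour_integral 0) (linepath a b)"
  proof (rule Cauchy_transform_eq_0[where M = "norm (poly p z0)"])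
    show "((\<lambda>z. poly p z ^ i * (poly f z * poly (pderiv p) z)) has_contour_integral 0) (linepath a b)" for i
      by (rule moments_by_parts[OF assms(1,2) moments])
  qed (use z0 seg t in \<open>auto intro!: continuous_intros\<close>)
  moreover have "((\<lambda>z. poly f z * poly (pderiv p) z / (poly p z - t)) has_contour_integral
      (\<Sum>k\<in>K. E (r k) + poly f (r k) * (Ln (1 - b / r k) - Ln (1 - a / r k)))) (linepath a b)"
  proof (rule has_contour_integral_eq)
    show "((\<lambda>z. \<Sum>k\<in>K. poly f z / (z - r k)) has_contour_integral
      (\<Sum>k\<in>K. E (r k) + poly f (r k) * (Ln (1 - b / r k) - Ln (1 - a / r k)))) (linepath a b)"
      by (intro has_contour_integral_sum E \<open>finite K\<close>) (use root R in \<open>auto intro: less_trans\<close>)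
    fix z assume "z \<in> path_image (linepath a b)"
    then have "poly p z \<noteq> t" using t[of z] seg by auto
    from pderiv_quotient_partial_fractions[OF \<open>finite K\<close> p this]
    have "poly f z * poly (pderiv p) z / (poly p z - t) = poly f z * (\<Sum>k\<in>K. 1 / (z - r k))"
      by (metis times_divide_eq_right)
    then show "(\<Sum>k\<in>K. poly f z / (z - r k)) = poly f z * poly (pderiv p) z / (poly p z - t)"
      by (simp add: sum_distrib_left)
  qed
  ultimately show ?thesis using has_contour_integral_unique by blast
qed

text \<open>The principal logarithms are available only near w1. On the simply connected S they are
  replaced by holomorphic logarithms of \<open>g k - a\<close> and \<open>g k - b\<close>, which
  exist because p vanishes at a and b while exp does not vanish. These logarithms and the constants
  C are chosen before f, and only E depends on f.\<close>

lemma moment_vanishing_continuation: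
  fixes p :: "complex poly"
  assumes deg: "degree p > 0" and ab: "poly p a = 0" "poly p b = 0"
    and S: "open S" "simply_connected S"
    and reg: "\<And>w z. w \<in> S \<Longrightarrow> poly p z = exp w \<Longrightarrow> poly (pderiv p) z \<noteq> 0"
    and K: "finite K" "\<And>k. k \<in> K \<Longrightarrow> g k holomorphic_on S"
      "\<And>w. w \<in> S \<Longrightarrow> bij_betw (\<lambda>k. g k w) K {z. poly p z = exp w}"
    and w1: "w1 \<in> S" and R: "norm a < R" "norm b < R"
      "\<And>z. z \<in> cball 0 R \<Longrightarrow> norm (poly p z) < norm (exp w1)"
  obtains LA LB C where
    "\<And>k. k \<in> K \<Longrightarrow> LA k holomorphic_on S" "\<And>k w. k \<in> K \<Longrightarrow> w \<in> S \<Longrightarrow> exp (LA k w) = g k w - a"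
    "\<And>k. k \<in> K \<Longrightarrow> LB k holomorphic_on S" "\<And>k w. k \<in> K \<Longrightarrow> w \<in> S \<Longrightarrow> exp (LB k w) = g k w - b"
    "\<And>f. (\<And>i. ((\<lambda>z. poly p z ^ i * poly (pderiv f) z) has_contour_integral 0) (linepath a b)) \<Longrightarrow>
      \<exists>E. \<forall>w\<in>S. (\<Sum>k\<in>K. E (g k w) + poly f (g k w) * (LB k w - LA k w + C k)) = 0"
proof -
  have pg: "poly p (g k w) = exp w" if "k \<in> K" "w \<in> S" for k w
    using bij_betwE[OF K(3)[OF that(2)]] that(1) by simp
  have log: "\<exists>L. L holomorphic_on S \<and> (\<forall>w\<in>S. exp (L w) = g k w - x)" if "k \<in> K" "poly p x = 0" for k x
  proof -
    have "g k w - x \<noteq> 0" if "w \<in> S" for w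
      using pg[OF \<open>k \<in> K\<close> that] \<open>poly p x = 0\<close> by auto
    moreover have "(\<lambda>w. g k w - x) holomorphic_on S" by (intro holomorphic_intros K that)
    ultimately show ?thesis
      using simply_connected_imp_holomorphic_log[OF _ S(2) open_imp_locally_path_connected[OF S(1)], of "\<lambda>w. g k w - x"]
      by metis
  qed
  have "\<forall>k\<in>K. \<exists>L. L holomorphic_on S \<and> (\<forall>w\<in>S. exp (L w) = g k w - a)"
    using log ab by blast
  from bchoice[OF this] obtain LA
    where "\<And>k. k \<in> K \<Longrightarrow> LA k holomorphic_on S \<and> (\<forall>w\<in>S. exp (LA k w) = g k w - a)" by blast
  then have LA: "\<And>k. k \<in> K \<Longrightarrow> LA k holomorphic_on S"
    "\<And>k w. k \<in> K \<Longrightarrow> w \<in> S \<Longrightarrow> exp (LA k w) = g k w - a" by blast+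
  have "\<forall>k\<in>K. \<exists>L. L holomorphic_on S \<and> (\<forall>w\<in>S. exp (L w) = g k w - b)"
    using log ab by blast
  from bchoice[OF this] obtain LB
    where "\<And>k. k \<in> K \<Longrightarrow> LB k holomorphic_on S \<and> (\<forall>w\<in>S. exp (LB k w) = g k w - b)" by blast
  then have LB: "\<And>k. k \<in> K \<Longrightarrow> LB k holomorphic_on S"
    "\<And>k w. k \<in> K \<Longrightarrow> w \<in> S \<Longrightarrow> exp (LB k w) = g k w - b" by blast+
  have R0: "R > 0" using R(1) norm_ge_zero[of a] by linarith
  define D where "D k w = Ln (1 - b / g k w) - Ln (1 - a / g k w)" for k w
  \<comment> \<open>D and LB - LA are logarithms of the same quotient (g - b) / (g - a) near w1, so
    their difference is constant there.\<close>
  define C where "C k = D k w1 - (LB k w1 - LA k w1)" for k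
  define U where "U = S \<inter> {w. \<forall>z\<in>cball 0 R. norm (poly p z) < norm (exp w)}"
  \<comment> \<open>The maximum of |p| on the disc, attained at z0, replaces the condition over all
    z by a single open one.\<close>
  obtain \<delta> where \<delta>: "\<delta> > 0" "ball w1 \<delta> \<subseteq> U"
  proof -
    have "R \<ge> 0" using R(1) norm_ge_zero[of a] by linarith
    then obtain z0 where z0: "z0 \<in> cball 0 R" "\<And>z. z \<in> cball 0 R \<Longrightarrow> norm (poly p z) \<le> norm (poly p z0)"
      by (rule poly_norm_attains_sup[of R p]) blast
    have "open (S \<inter> {w. norm (poly p z0) < norm (exp w)})"
      by (intro open_Int S open_Collect_less continuous_intros)
    moreover have "w1 \<in> S \<inter> {w. norm (poly p z0) < norm (exp w)}" using w1 R(3)[OF z0(1)] by simp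
    ultimately obtain \<delta> where "\<delta> > 0" "ball w1 \<delta> \<subseteq> S \<inter> {w. norm (poly p z0) < norm (exp w)}"
      unfolding open_contains_ball by blast
    moreover have "S \<inter> {w. norm (poly p z0) < norm (exp w)} \<subseteq> U"
      using le_less_trans[OF z0(2)] unfolding U_def by blast
    ultimately show ?thesis using that by blast
  qed
  have big: "norm (g k w) > R" if "k \<in> K" "w \<in> ball w1 \<delta>" for k w
  proof (rule ccontr)
    assume "\<not> ?thesis"
    then have "g k w \<in> cball 0 R" by simp
    moreover have "w \<in> U" using that(2) \<delta>(2) by blast
    ultimately have "norm (poly p (g k w)) < norm (exp w)" "w \<in> S" by (simp_all add: U_def)
    then show False using pg[OF that(1)] by simp
  qed
  have D_eq: "D k w = LB k w - LA k w + C k" if k: "k \<in> K" and w: "w \<in> ball w1 \<delta>" for k w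
  proof -
    have sub: "ball w1 \<delta> \<subseteq> S" using \<delta>(2) by (auto simp: U_def)
    have slit: "1 - x / g k v \<notin> \<real>\<^sub>\<le>\<^sub>0" if "v \<in> ball w1 \<delta>" "norm x < R" for v x
    proof -
      have "norm x < norm (g k v)" using big[OF k that(1)] that(2) by linarith
      then have "norm (x / g k v) < 1" by (simp add: norm_divide divide_less_eq)
      then have "Re (x / g k v) < 1" using complex_Re_le_cmod[of "x / g k v"] by linarith
      then show ?thesis by (auto simp: complex_nonpos_Reals_iff)
    qed
    have gnz: "g k v \<noteq> 0" if "v \<in> ball w1 \<delta>" for v using big[OF k that] R0 by auto
    have cg: "continuous_on (ball w1 \<delta>) (g k)"
      using K(2)[OF k] sub holomorphic_on_imp_continuous_on continuous_on_subset by blast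
    have "D k w - D k w1 = (LB k w - LA k w) - (LB k w1 - LA k w1)"
    proof (rule exp_eq_imp_increment_eq[of "ball w1 \<delta>"])
      show "continuous_on (ball w1 \<delta>) (D k)"
        unfolding D_def by (intro continuous_intros cg) (use slit R gnz in auto)
      show "continuous_on (ball w1 \<delta>) (\<lambda>w. LB k w - LA k w)"
        using LA(1)[OF k] LB(1)[OF k] sub
        by (intro continuous_intros holomorphic_on_imp_continuous_on) (meson holomorphic_on_subset)+
      fix v assume v: "v \<in> ball w1 \<delta>"
      have nz: "1 - b / g k v \<noteq> 0" "1 - a / g k v \<noteq> 0"
        using slit[OF v R(1)] slit[OF v R(2)] by (intro notI, simp)+
      have "exp (D k v) = (1 - b / g k v) / (1 - a / g k v)"
        using nz by (simp add: D_def exp_diff)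
      also have "\<dots> = (g k v - b) / (g k v - a)"
        using gnz[OF v] nz by (simp add: divide_simps)
      also have "\<dots> = exp (LB k v - LA k v)"
        using LA(2)[OF k] LB(2)[OF k] v sub by (simp add: exp_diff subset_iff)
      finally show "exp (D k v) = exp (LB k v - LA k v)" .
    qed (use w \<delta>(1) in auto)
    then show ?thesis by (simp add: C_def algebra_simps)
  qed
  have sum_0: "\<exists>E. \<forall>w\<in>S. (\<Sum>k\<in>K. E (g k w) + poly f (g k w) * (LB k w - LA k w + C k)) = 0"
    if f: "\<And>i. ((\<lambda>z. poly p z ^ i * poly (pderiv f) z) has_contour_integral 0) (linepath a b)" for f
  proof -
    obtain E where E: "E holomorphic_on UNIV"
      "\<And>r. norm a < norm r \<Longrightarrow> norm b < norm r \<Longrightarrow>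
      ((\<lambda>z. poly f z / (z - r)) has_contour_integral
        E r + poly f r * (Ln (1 - b / r) - Ln (1 - a / r))) (linepath a b)"
      by (rule contour_integral_partial_fraction[of a b f]) blast
    define \<Phi> where "\<Phi> w = (\<Sum>k\<in>K. E (g k w) + poly f (g k w) * (LB k w - LA k w + C k))" for w
    have "\<Phi> w = 0" if "w \<in> S" for w
    \<comment> \<open>The fibre identity holds on the ball around w1 and spreads over the connected
      S by the identity theorem.\<close>
    proof (rule analytic_continuation_open[of "ball w1 \<delta>" S \<Phi> "\<lambda>_. 0"])
      show "ball w1 \<delta> \<subseteq> S" using \<delta>(2) by (auto simp: U_def)
      show "connected S" using S(2) by (rule simply_connected_imp_connected)
      have "(\<lambda>w. E (g k w)) holomorphic_on S" if "k \<in> K" for k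
        using holomorphic_on_compose[OF K(2)[OF that] holomorphic_on_subset[OF E(1)]] by (simp add: o_def)
      then show "\<Phi> holomorphic_on S"
        unfolding \<Phi>_def by (intro holomorphic_intros LA(1) LB(1) K(2))
      fix w assume w: "w \<in> ball w1 \<delta>"
      then have wS: "w \<in> S" using \<delta>(2) by (auto simp: U_def)
      have "\<Phi> w = (\<Sum>k\<in>K. E (g k w) + poly f (g k w) * (Ln (1 - b / g k w) - Ln (1 - a / g k w)))"
        unfolding \<Phi>_def by (intro sum.cong refl) (simp add: D_eq[OF _ w, symmetric] D_def)
      also have "\<dots> = 0"
        by (rule moment_vanishing_fibre_identity[OF ab f R(1,2) E(2) K(1)
              branches_decompose[OF deg reg[OF wS] K(3)[OF wS]]])
           (use w \<delta>(2) in \<open>auto simp: U_def\<close>)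
      finally show "\<Phi> w = 0" .
    qed (use S \<delta>(1) that in auto)
    then show ?thesis unfolding \<Phi>_def by blast
  qed
  show ?thesis by (rule that[OF LA LB sum_0])
qed

section \<open>Comparison of the roots near the endpoints\<close>

text \<open>The shift by \<omega> permutes the finitely many members, and a positive power of this
  permutation is the identity.\<close>

lemma shifted_family_common_period:
  fixes g :: "'k \<Rightarrow> 'a::comm_semiring_1 \<Rightarrow> 'b" and H :: "'a set"
  assumes "finite K" and H: "\<And>w. w \<in> H \<Longrightarrow> w + \<omega> \<in> H" "H \<noteq> {}"
    and inj: "\<And>w. w \<in> H \<Longrightarrow> inj_on (\<lambda>k. g k w) K"
    and shift: "\<And>k. k \<in> K \<Longrightarrow> \<exists>j\<in>K. \<forall>w\<in>H. g k (w + \<omega>) = g j w"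
  obtains N where "N > 0" "\<And>k w. k \<in> K \<Longrightarrow> w \<in> H \<Longrightarrow> g k (w + of_nat N * \<omega>) = g k w"
proof -
  obtain \<sigma> where \<sigma>: "\<And>k. k \<in> K \<Longrightarrow> \<sigma> k \<in> K \<and> (\<forall>w\<in>H. g k (w + \<omega>) = g (\<sigma> k) w)"
    using shift by metis
  \<comment> \<open>Outside K the map is the identity, as \<open>permutes\<close> demands.\<close>
  define s where "s k = (if k \<in> K then \<sigma> k else k)" for k
  have s: "s k \<in> K" "\<And>w. w \<in> H \<Longrightarrow> g k (w + \<omega>) = g (s k) w" if "k \<in> K" for k
    using \<sigma>[OF that] that by (auto simp: s_def)
  have "inj_on s K"
  proof (rule inj_onI)
    fix k l assume kl: "k \<in> K" "l \<in> K" "s k = s l"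
    obtain w where w: "w \<in> H" using H(2) by blast
    have "g k (w + \<omega>) = g l (w + \<omega>)" using s(2)[OF kl(1) w] s(2)[OF kl(2) w] kl(3) by simp
    then show "k = l" using inj_onD[OF inj[OF H(1)[OF w]]] kl by blast
  qed
  moreover have "s ` K \<subseteq> K" using s(1) by blast
  ultimately have "bij_betw s K K"
    using endo_inj_surj[OF \<open>finite K\<close>] by (simp add: bij_betw_def)
  then have "s permutes K" by (rule bij_imp_permutes) (simp add: s_def)
  then have "permutation s" using \<open>finite K\<close> permutation_permutes by blast
  then obtain N where N: "s ^^ N = id" "N > 0" by (rule permutation_is_nilpotent)
  have iter: "(s ^^ m) k \<in> K \<and> (\<forall>w\<in>H. g k (w + of_nat m * \<omega>) = g ((s ^^ m) k) w)" if "k \<in> K" for m k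
  proof (induction m)
    case (Suc m)
    have "g k (w + of_nat (Suc m) * \<omega>) = g ((s ^^ Suc m) k) w" if w: "w \<in> H" for w
    proof -
      have "w + of_nat (Suc m) * \<omega> = (w + \<omega>) + of_nat m * \<omega>" by (simp add: algebra_simps)
      then have "g k (w + of_nat (Suc m) * \<omega>) = g ((s ^^ m) k) (w + \<omega>)"
        using Suc.IH H(1)[OF w] by presburger
      also have "\<dots> = g ((s ^^ Suc m) k) w" using s(2)[OF _ w] Suc.IH by simp
      finally show ?thesis .
    qed
    then show ?case using Suc.IH s(1) by simp
  qed (use that in simp)
  have "g k (w + of_nat N * \<omega>) = g k w" if "k \<in> K" "w \<in> H" for k w
    using iter[OF that(1), of N] that(2) N(1) by simp
  then show ?thesis using that N(2) by blast
qed

text \<open>A translation by \<Omega> = 2 pi i N fixes all branches on the half plane H. Subtracting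
  the continued identity at w from the one at w + \<Omega> therefore cancels everything but the
  increments of the logarithms, which are \<Omega> divided by the multiplicity on branches tending
  to the endpoint in question and zero on the others. The sets A and B label the branches tending to
  a and to b.\<close>

lemma moment_vanishing_root_relation:
  fixes p :: "complex poly"
  assumes deg: "degree p > 0" and ab: "poly p a = 0" "poly p b = 0"
  obtains A B :: "complex set" and r :: "complex \<Rightarrow> nat \<Rightarrow> complex" and \<tau> :: "nat \<Rightarrow> complex"
    where "finite A" "finite B" "card A = order a p" "card B = order b p" "a \<noteq> b \<Longrightarrow> A \<inter> B = {}"
      "inj \<tau>" "\<And>k m. k \<in> A \<union> B \<Longrightarrow> poly p (r k m) = \<tau> m"
      "\<And>k. k \<in> A \<Longrightarrow> r k \<longlonglongrightarrow> a" "\<And>k. k \<in> B \<Longrightarrow> r k \<longlonglongrightarrow> b"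
      "\<And>f m. (\<And>i. ((\<lambda>z. poly p z ^ i * poly (pderiv f) z) has_contour_integral 0) (linepath a b)) \<Longrightarrow>
        (\<Sum>k\<in>A. poly f (r k m)) / of_nat (order a p) = (\<Sum>k\<in>B. poly f (r k m)) / of_nat (order b p)"
proof -
  have "p \<noteq> 0" using deg by auto
  define CV where "CV = poly p ` {z. poly (pderiv p) z = 0}"
  have "pderiv p \<noteq> 0" using deg by (simp add: pderiv_eq_0_iff)
  then have finCV: "finite CV" unfolding CV_def using poly_roots_finite by blast
  define R where "R = norm a + norm b + 1"
  have R: "norm a < R" "norm b < R" "R \<ge> 0"
    using norm_ge_zero[of a] norm_ge_zero[of b] by (simp_all add: R_def add_pos_nonneg add_nonneg_pos)
  obtain z0 where z0: "\<And>z. z \<in> cball 0 R \<Longrightarrow> norm (poly p z) \<le> norm (poly p z0)"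
    using R(3) by (rule poly_norm_attains_sup[of R p]) blast
  \<comment> \<open>The real part of w1 makes |exp w1| equal to the maximum of |p| on the disc plus
    1, which puts w1 in the range of the fibre identity.\<close>
  obtain S M w1 where S: "open S" "simply_connected S" "{w. Re w < - M} \<subseteq> S" "w1 \<in> S"
    "Re w1 = ln (norm (poly p z0) + 1)" and SCV: "\<And>w. w \<in> S \<Longrightarrow> exp w \<notin> CV"
    by (rule slit_strip_domain[OF finCV, of "ln (norm (poly p z0) + 1)"]) blast
  have reg: "poly (pderiv p) z \<noteq> 0" if "w \<in> S" "poly p z = exp w" for w z
    using SCV[OF that(1)] that(2) unfolding CV_def by force
  obtain K :: "complex set" and g where K: "finite K" "\<And>k. k \<in> K \<Longrightarrow> g k holomorphic_on S"
      "\<And>w. w \<in> S \<Longrightarrow> bij_betw (\<lambda>k. g k w) K {z. poly p z = exp w}"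
    and lift: "\<And>h T. T \<subseteq> S \<Longrightarrow> connected T \<Longrightarrow> T \<noteq> {} \<Longrightarrow> continuous_on T h \<Longrightarrow> (\<And>w. w \<in> T \<Longrightarrow> poly p (h w) = exp w)
         \<Longrightarrow> \<exists>k\<in>K. \<forall>w\<in>T. h w = g k w"
    by (rule exp_root_branches[OF deg S(1,2,4) reg]) blast+
  have w1_far: "norm (poly p z) < norm (exp w1)" if "z \<in> cball 0 R" for z
  proof -
    have "norm (poly p z) < norm (poly p z0) + 1" using z0[OF that] by simp
    also have "\<dots> = exp (Re w1)" unfolding S(5) by (simp add: add_nonneg_pos)
    finally show ?thesis by simp
  qed
  obtain LA LB C where
    LA: "\<And>k. k \<in> K \<Longrightarrow> LA k holomorphic_on S" "\<And>k w. k \<in> K \<Longrightarrow> w \<in> S \<Longrightarrow> exp (LA k w) = g k w - a" and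
    LB: "\<And>k. k \<in> K \<Longrightarrow> LB k holomorphic_on S" "\<And>k w. k \<in> K \<Longrightarrow> w \<in> S \<Longrightarrow> exp (LB k w) = g k w - b" and
    sum_0: "\<And>f. (\<And>i. ((\<lambda>z. poly p z ^ i * poly (pderiv f) z) has_contour_integral 0) (linepath a b)) \<Longrightarrow>
      \<exists>E. \<forall>w\<in>S. (\<Sum>k\<in>K. E (g k w) + poly f (g k w) * (LB k w - LA k w + C k)) = 0"
    by (rule moment_vanishing_continuation[OF deg ab S(1,2) reg K S(4) R(1,2) w1_far]) blast+
  have "finite {z. poly p z = 0}" using \<open>p \<noteq> 0\<close> by (rule poly_roots_finite)
  then obtain \<epsilon> where \<epsilon>: "\<epsilon> > 0"
    and sep': "\<And>c c'. c \<in> {z. poly p z = 0} \<Longrightarrow> c' \<in> {z. poly p z = 0} \<Longrightarrow> c \<noteq> c' \<Longrightarrow> ball c \<epsilon> \<inter> ball c' \<epsilon> = {}"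
    by (rule finite_disjoint_balls) blast
  have sep: "ball c \<epsilon> \<inter> ball c' \<epsilon> = {}" if "poly p c = 0" "poly p c' = 0" "c \<noteq> c'" for c c'
    using sep' that by simp
  define q where "q = norm (lead_coeff p) * \<epsilon> ^ degree p"
  have q: "q > 0" using \<epsilon> \<open>p \<noteq> 0\<close> by (simp add: q_def)
  \<comment> \<open>The bound M keeps H inside S; the bound - ln q gives |exp w| < q, the threshold
    below which each branch stays near one zero of p.\<close>
  define M' where "M' = max M (- ln q)"
  define H where "H = {w. Re w < - M'}"
  have HS: "H \<subseteq> S" using S(3) by (auto simp: H_def M'_def)
  have H: "connected H" "H \<noteq> {}"
    unfolding H_def using convex_connected[OF convex_halfspace_Re_lt[of "- M'"]]
    by (auto intro!: exI[of _ "of_real (- M' - 1)"])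
  have pg: "poly p (g k w) = exp w" if "k \<in> K" "w \<in> S" for k w
    using bij_betwE[OF K(3)[OF that(2)]] that(1) by simp
  have cont_g: "continuous_on H (g k)" if "k \<in> K" for k
    using K(2)[OF that] HS holomorphic_on_imp_continuous_on continuous_on_subset by blast
  have "\<exists>c. poly p c = 0 \<and> (\<forall>w\<in>H. g k w \<in> ball c \<epsilon>)" if k: "k \<in> K" for k
  proof (rule lift_clusters_at_root[OF \<open>p \<noteq> 0\<close> _ sep H cont_g[OF k]])
    fix w assume w: "w \<in> H"
    then have "exp (Re w) < exp (ln q)" by (simp add: H_def M'_def)
    then have "exp (Re w) < q" using q by simp
    then show "norm (poly p (g k w)) < norm (lead_coeff p) * \<epsilon> ^ degree p"
      using pg[OF k, of w] w HS by (simp add: q_def subset_iff)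
  qed (use \<epsilon> in auto)
  then obtain c where c: "\<And>k. k \<in> K \<Longrightarrow> poly p (c k) = 0 \<and> (\<forall>w\<in>H. g k w \<in> ball (c k) \<epsilon>)"
    by metis
  define \<omega> where "\<omega> = complex_of_real (2 * pi) * \<i>"
  have H_shift: "w + of_nat n * \<omega> \<in> H" if "w \<in> H" for w n
    using that by (simp add: H_def \<omega>_def)
  have H_shift1: "w + \<omega> \<in> H" if "w \<in> H" for w using H_shift[OF that, of 1] by simp
  have inj_K: "inj_on (\<lambda>k. g k w) K" if "w \<in> H" for w
    using K(3) that HS by (meson bij_betw_imp_inj_on subsetD)
  \<comment> \<open>Since exp has period \<omega>, the translated branch solves the same equation on
    H and is therefore again a branch.\<close>
  have shift_K: "\<exists>j\<in>K. \<forall>w\<in>H. g k (w + \<omega>) = g j w" if k: "k \<in> K" for k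
  proof (rule lift[OF HS H])
    show "continuous_on H (\<lambda>w. g k (w + \<omega>))"
      by (rule continuous_on_compose2[OF cont_g[OF k]])
         (use H_shift1 in \<open>auto intro!: continuous_intros\<close>)
    fix w assume "w \<in> H"
    then have "w + \<omega> \<in> S" using H_shift1 HS by blast
    moreover have "exp \<omega> = 1" by (simp add: \<omega>_def exp_eq_1)
    ultimately show "poly p (g k (w + \<omega>)) = exp w"
      using pg[OF k] by (simp add: exp_add)
  qed
  obtain N where N: "N > 0" "\<And>k w. k \<in> K \<Longrightarrow> w \<in> H \<Longrightarrow> g k (w + of_nat N * \<omega>) = g k w"
    by (rule shifted_family_common_period[OF K(1) H_shift1 H(2) inj_K shift_K]) blast+
  define \<Omega> where "\<Omega> = of_nat N * \<omega>"
  have \<Omega>: "\<Omega> \<noteq> 0" using N(1) by (simp add: \<Omega>_def \<omega>_def)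
  have increment: "L (w + \<Omega>) - L w = (if c k = x then \<Omega> / of_nat (order x p) else 0)"
    if k: "k \<in> K" and w: "w \<in> H" and L: "L holomorphic_on S" "\<And>v. v \<in> S \<Longrightarrow> exp (L v) = g k v - x"
      and x: "poly p x = 0" for k w L x
  proof -
    have "w + \<Omega> \<in> H" using H_shift[OF w] by (simp add: \<Omega>_def)
    moreover have "continuous_on H L"
      using L(1) HS holomorphic_on_imp_continuous_on continuous_on_subset by blast
    moreover have "z = c k" if "z \<in> ball (c k) \<epsilon>" "poly p z = 0" for z
      using sep[of z "c k"] c[OF k] that \<epsilon> by (metis IntI centre_in_ball empty_iff)
    ultimately have inc: "x \<noteq> c k \<Longrightarrow> L (w + \<Omega>) = L w"
      "x = c k \<Longrightarrow> of_nat (order x p) * (L (w + \<Omega>) - L w) = (w + \<Omega>) - w"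
      using log_increment_at_root[OF H(1) w _ cont_g[OF k], of "w + \<Omega>" "c k" \<epsilon> p L x]
        c[OF k] pg[OF k] HS L(2) N(2)[OF k w] x \<open>p \<noteq> 0\<close> by (auto simp: \<Omega>_def subset_iff)
    show ?thesis
    proof (cases "c k = x")
      case True
      have "of_nat (order x p) \<noteq> (0 :: complex)" using x \<open>p \<noteq> 0\<close> by (simp add: order_root)
      moreover have "(L (w + \<Omega>) - L w) * of_nat (order x p) = \<Omega>"
        using inc(2) True by (simp add: mult.commute)
      ultimately have "L (w + \<Omega>) - L w = \<Omega> / of_nat (order x p)"
        by (rule nonzero_eq_divide_eq[THEN iffD2])
      then show ?thesis using True by simp
    qed (use inc(1) in auto)
  qed
  define A where "A = {k\<in>K. c k = a}"
  define B where "B = {k\<in>K. c k = b}"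
  have relation: "(\<Sum>k\<in>A. poly f (g k w)) / of_nat (order a p) = (\<Sum>k\<in>B. poly f (g k w)) / of_nat (order b p)"
    if w: "w \<in> H" and f: "\<And>i. ((\<lambda>z. poly p z ^ i * poly (pderiv f) z) has_contour_integral 0) (linepath a b)" for f w
  proof -
    obtain E where E: "\<And>w. w \<in> S \<Longrightarrow> (\<Sum>k\<in>K. E (g k w) + poly f (g k w) * (LB k w - LA k w + C k)) = 0"
      using sum_0[OF f] by blast
    have sum_filter: "(\<Sum>k\<in>K. if c k = x then y * F k else 0) = y * sum F {k\<in>K. c k = x}"
      for x y :: complex and F
      by (subst sum.inter_filter[OF K(1)]) (auto simp: sum_distrib_left intro!: sum.cong)
    have w': "w + \<Omega> \<in> H" using H_shift[OF w] by (simp add: \<Omega>_def)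
    have g': "g k (w + \<Omega>) = g k w" if "k \<in> K" for k using N(2)[OF that w] by (simp add: \<Omega>_def)
    \<comment> \<open>Both sums are zero; the terms with E and C agree because the branches
      return.\<close>
    have "0 = (\<Sum>k\<in>K. E (g k (w + \<Omega>)) + poly f (g k (w + \<Omega>)) * (LB k (w + \<Omega>) - LA k (w + \<Omega>) + C k))
        - (\<Sum>k\<in>K. E (g k w) + poly f (g k w) * (LB k w - LA k w + C k))"
      using E w w' HS by (simp add: subset_iff)
    also have "\<dots> = (\<Sum>k\<in>K. poly f (g k w) * ((LB k (w + \<Omega>) - LB k w) - (LA k (w + \<Omega>) - LA k w)))"
      unfolding sum_subtractf[symmetric]
    proof (intro sum.cong refl)
      fix k assume "k \<in> K"
      from g'[OF this] show "E (g k (w + \<Omega>)) + poly f (g k (w + \<Omega>)) * (LB k (w + \<Omega>) - LA k (w + \<Omega>) + C k) -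
          (E (g k w) + poly f (g k w) * (LB k w - LA k w + C k)) =
          poly f (g k w) * ((LB k (w + \<Omega>) - LB k w) - (LA k (w + \<Omega>) - LA k w))"
        by (simp only:) (simp add: algebra_simps)
    qed
    also have "\<dots> = (\<Sum>k\<in>K. (if c k = b then \<Omega> / of_nat (order b p) * poly f (g k w) else 0)
        - (if c k = a then \<Omega> / of_nat (order a p) * poly f (g k w) else 0))"
    proof (intro sum.cong refl)
      fix k assume k: "k \<in> K"
      show "poly f (g k w) * ((LB k (w + \<Omega>) - LB k w) - (LA k (w + \<Omega>) - LA k w)) =
          (if c k = b then \<Omega> / of_nat (order b p) * poly f (g k w) else 0)
          - (if c k = a then \<Omega> / of_nat (order a p) * poly f (g k w) else 0)"
        using increment[OF k w LA(1)[OF k] _ ab(1)] increment[OF k w LB(1)[OF k] _ ab(2)]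
          LA(2)[OF k] LB(2)[OF k] by (simp add: right_diff_distrib)
    qed
    also have "\<dots> = \<Omega> / of_nat (order b p) * (\<Sum>k\<in>B. poly f (g k w))
        - \<Omega> / of_nat (order a p) * (\<Sum>k\<in>A. poly f (g k w))"
      unfolding sum_subtractf A_def B_def sum_filter ..
    finally have "\<Omega> * ((\<Sum>k\<in>A. poly f (g k w)) / of_nat (order a p)) =
        \<Omega> * ((\<Sum>k\<in>B. poly f (g k w)) / of_nat (order b p))" by simp
    then show ?thesis by (rule mult_left_cancel[OF \<Omega>, THEN iffD1])
  qed
  \<comment> \<open>A sequence in H running to the left along the real axis, so that \<tau> m = exp
    (v m) tends to 0 through distinct values.\<close>
  define v where "v m = complex_of_real (- (M' + 1 + real m))" for m
  define r where "r k m = g k (v m)" for k m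
  have v: "v m \<in> H" for m by (simp add: v_def H_def)
  have "(\<lambda>m. exp (- (M' + 1 + real m))) \<longlonglongrightarrow> 0" by real_asymp
  then have \<tau>_lim: "(\<lambda>m. exp (v m)) \<longlonglongrightarrow> 0"
    unfolding v_def exp_of_real using tendsto_of_real[of _ 0] by fastforce
  have pr: "poly p (r k m) = exp (v m)" if "k \<in> K" for k m
    unfolding r_def by (rule pg[OF that]) (use v HS in blast)
  have r_lim: "r k \<longlonglongrightarrow> c k" if k: "k \<in> K" for k
    by (rule lift_tendsto_root[OF \<open>p \<noteq> 0\<close> \<epsilon> sep]) (use c[OF k] v \<tau>_lim pr[OF k] in \<open>auto simp: r_def\<close>)
  have card: "order x p = card {k\<in>K. c k = x}" for x
  proof (rule order_eq_card_limits[OF K(1) \<open>p \<noteq> 0\<close> _ \<tau>_lim r_lim])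
    fix m
    have "v m \<in> S" using v HS by blast
    then show "p - [:exp (v m):] = smult (lead_coeff p) (\<Prod>k\<in>K. [:- r k m, 1:])"
      unfolding r_def by (intro branches_decompose[OF deg reg K(3)])
  qed
  have inj: "inj (\<lambda>m. exp (v m))"
  proof (rule injI)
    fix m n assume "exp (v m) = exp (v n)"
    then have "complex_of_real (exp (- (M' + 1 + real m))) = complex_of_real (exp (- (M' + 1 + real n)))"
      unfolding v_def exp_of_real .
    then show "m = n" by simp
  qed
  show ?thesis
  proof (rule that[of A B "\<lambda>m. exp (v m)" r])
    show "finite A" "finite B" using K(1) by (auto simp: A_def B_def)
    show "card A = order a p" "card B = order b p" by (simp_all add: A_def B_def card)
    show "A \<inter> B = {}" if "a \<noteq> b" using that by (auto simp: A_def B_def)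
    show "poly p (r k m) = exp (v m)" if "k \<in> A \<union> B" for k m
      using that pr by (auto simp: A_def B_def)
    show "r k \<longlonglongrightarrow> a" if "k \<in> A" for k using that r_lim by (auto simp: A_def)
    show "r k \<longlonglongrightarrow> b" if "k \<in> B" for k using that r_lim by (auto simp: B_def)
    show "(\<Sum>k\<in>A. poly f (r k m)) / of_nat (order a p) = (\<Sum>k\<in>B. poly f (r k m)) / of_nat (order b p)"
      if "\<And>i. ((\<lambda>z. poly p z ^ i * poly (pderiv f) z) has_contour_integral 0) (linepath a b)" for f m
      unfolding r_def by (rule relation[OF v that])
  qed (rule inj)
qed

section \<open>Coincident values and the common right factor\<close>

text \<open>Give each point of A the weight 1 / |A| and each point of B the weight -1 / |B|.
  Equality of the means of all powers makes the total weight over each value of x zero; if no point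
  of B shared the value \<open>x a\<close>, that total would be a nonzero multiple of 1 /
  |A|.\<close>

lemma common_fibre_value:
  fixes x :: "'k \<Rightarrow> 'a::field_char_0"
  assumes fin: "finite A" "finite B" and disj: "A \<inter> B = {}" and "a \<in> A"
    and moments: "\<And>j. j < card A + card B \<Longrightarrow>
      (\<Sum>k\<in>A. x k ^ j) / of_nat (card A) = (\<Sum>k\<in>B. x k ^ j) / of_nat (card B)"
  shows "\<exists>b\<in>B. x b = x a"
proof (rule ccontr)
  assume no: "\<not> ?thesis"
  define c :: "'k \<Rightarrow> 'a" where "c k = (if k \<in> A then 1 / of_nat (card A) else - 1 / of_nat (card B))" for k
  have c: "c k = 1 / of_nat (card A)" if "k \<in> A" for k using that by (simp add: c_def)
  have c': "c k = - 1 / of_nat (card B)" if "k \<in> B" for k using that disj by (auto simp: c_def)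
  have "(\<Sum>k | k \<in> A \<union> B \<and> x k = x a. c k) = 0"
  proof (rule moments_eq_0_imp_fibre_sum_eq_0)
    show "finite (A \<union> B)" using fin by simp
    have "card (x ` (A \<union> B)) \<le> card (A \<union> B)" using fin by (intro card_image_le) simp
    also have "\<dots> \<le> card A + card B" by (rule card_Un_le)
    finally show "card (x ` (A \<union> B)) \<le> card A + card B" .
    fix j assume "j < card A + card B"
    from moments[OF this] show "(\<Sum>k\<in>A \<union> B. c k * x k ^ j) = 0"
      by (simp add: sum.union_disjoint fin disj c c' sum_divide_distrib sum_negf)
  qed
  also have "{k. k \<in> A \<union> B \<and> x k = x a} = {k \<in> A. x k = x a}" using no by auto
  also have "(\<Sum>k\<in>{k \<in> A. x k = x a}. c k) = of_nat (card {k \<in> A. x k = x a}) / of_nat (card A)"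
    by (simp add: c)
  finally have "card {k \<in> A. x k = x a} = 0 \<or> card A = 0" by simp
  then show False using \<open>a \<in> A\<close> fin by auto
qed

text \<open>The extra factor \<open>P z ^ l\<close> carries the induction, since (P - c)^(i+1) P^l =
  (P - c)^i P^(l+1) - c (P - c)^i P^l.\<close>

lemma moments_shift:
  fixes P F :: "complex \<Rightarrow> complex"
  assumes "\<And>i. ((\<lambda>z. P z ^ i * F z) has_contour_integral 0) \<gamma>"
  shows "((\<lambda>z. (P z - c) ^ i * F z) has_contour_integral 0) \<gamma>"
proof -
  have "((\<lambda>z. (P z - c) ^ i * (P z ^ l * F z)) has_contour_integral 0) \<gamma>" for l
  proof (induction i arbitrary: l)
    case (Suc i)
    from has_contour_integral_diff[OF Suc[of "Suc l"] has_contour_integral_lmul[OF Suc[of l], of c]]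
    show ?case by (simp add: algebra_simps)
  qed (use assms in simp)
  from this[of 0] show ?thesis by simp
qed

lemma infinite_constant_subsequence:
  fixes h :: "nat \<Rightarrow> 'a"
  assumes "finite B" "\<And>m. h m \<in> B"
  obtains l e where "l \<in> B" "strict_mono (e :: nat \<Rightarrow> nat)" "\<And>n. h (e n) = l"
proof -
  have "finite (range h)" using assms by (meson finite_subset image_subsetI)
  then obtain m where "infinite {n. h n = h m}"
    using pigeonhole_infinite[of UNIV h] by auto
  then obtain e where "strict_mono (e :: nat \<Rightarrow> nat)" "\<forall>n. e n \<in> {n. h n = h m}"
    using infinite_enumerate by blast
  then show ?thesis using that[of "h m" e] assms(2) by simp
qed

text \<open>The polynomials that eventually agree along both sequences form a subalgebra. It is
  closed under exact division because a nonzero G vanishes at only finitely many points of the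
  injective sequence \<alpha>; this is why agreement is asked for only eventually. The generator
  also belongs to it, so its values at a and b agree in the limit.\<close>

lemma common_right_factor_of_coincident_sequences:
  fixes P Q :: "complex poly"
  assumes deg: "degree P > 0" and lim: "\<alpha> \<longlonglongrightarrow> a" "\<beta> \<longlonglongrightarrow> b"
    and "inj \<alpha>"
    and P: "\<And>n. poly P (\<alpha> n) = poly P (\<beta> n)" and Q: "\<And>n. poly Q (\<alpha> n) = poly Q (\<beta> n)"
  shows "\<exists>Pt Qt W. P = pcompose Pt W \<and> Q = pcompose Qt W \<and> poly W a = poly W b"
proof -
  define A where "A = {F. \<forall>\<^sub>F n in sequentially. poly F (\<alpha> n) = poly F (\<beta> n)}"
  have PA: "P \<in> A" and QA: "Q \<in> A" using P Q by (simp_all add: A_def)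
  have "\<exists>V\<in>A. \<forall>F\<in>A. \<exists>R. F = pcompose R V"
  proof (rule subalgebra_eq_polynomials_in_generator[of A P])
    show "[:c:] \<in> A" for c by (simp add: A_def)
    show "F + G \<in> A" if "F \<in> A" "G \<in> A" for F G
      using that unfolding A_def mem_Collect_eq by eventually_elim simp
    show "F * G \<in> A" if "F \<in> A" "G \<in> A" for F G
      using that unfolding A_def mem_Collect_eq by eventually_elim simp
    show "F \<in> A" if G: "G \<in> A" "G \<noteq> 0" and GF: "G * F \<in> A" for F G
    proof -
      have "finite (\<alpha> -` {z. poly G z = 0})"
        using G(2) \<open>inj \<alpha>\<close> by (intro finite_vimageI poly_roots_finite)
      then have "\<forall>\<^sub>F n in sequentially. poly G (\<alpha> n) \<noteq> 0"
        unfolding cofinite_eq_sequentially[symmetric] eventually_cofinite by (simp add: vimage_def)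
      then show ?thesis
        using G(1) GF unfolding A_def mem_Collect_eq by eventually_elim simp
    qed
  qed (use PA deg in blast)+
  then obtain V where V: "V \<in> A" "\<And>F. F \<in> A \<Longrightarrow> \<exists>R. F = pcompose R V" by blast
  have "(\<lambda>n. poly V (\<alpha> n)) \<longlonglongrightarrow> poly V a" "(\<lambda>n. poly V (\<beta> n)) \<longlonglongrightarrow> poly V b"
    using lim by (auto intro!: tendsto_intros)
  moreover have "\<forall>\<^sub>F n in sequentially. poly V (\<alpha> n) = poly V (\<beta> n)" using V(1) by (simp add: A_def)
  ultimately have "poly V a = poly V b"
    by (blast intro: LIMSEQ_unique[of "\<lambda>n. poly V (\<beta> n)"] Lim_transform_eventually)
  then show ?thesis using V(2)[OF PA] V(2)[OF QA] by blast
qed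

theorem theorem2:
  fixes P Q :: "complex poly" and a b :: complex and \<gamma> :: "real \<Rightarrow> complex"
  assumes "degree P > 0"
    and "a \<noteq> b"
    and "poly P a = poly P b"
    and "valid_path \<gamma>" and "pathstart \<gamma> = a" and "pathfinish \<gamma> = b"
    and "\<And>i j :: nat. j \<le> point_multiplicity P a + point_multiplicity P b - 2 \<Longrightarrow>
           ((\<lambda>z. poly P z ^ i * poly Q z ^ j * poly (pderiv Q) z) has_contour_integral 0) \<gamma>"
  shows "\<exists>Pt Qt W :: complex poly.
           P = pcompose Pt W \<and> Q = pcompose Qt W \<and> poly W a = poly W b"
proof -
  define p where "p = P - [:poly P a:]"
  have deg: "degree p > 0" using assms(1) by (simp add: p_def degree_minus_const)
  have ab: "poly p a = 0" "poly p b = 0" using assms(3) by (simp_all add: p_def)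
  have mult: "point_multiplicity P a = order a p" "point_multiplicity P b = order b p"
    using assms(3) by (simp_all add: point_multiplicity_def p_def)
  have pos: "order a p \<ge> 1" "order b p \<ge> 1"
    unfolding mult[symmetric] by (rule point_multiplicity_pos[OF assms(1)])+
  obtain A B :: "complex set" and r :: "complex \<Rightarrow> nat \<Rightarrow> complex" and \<tau> :: "nat \<Rightarrow> complex"
    where AB: "finite A" "finite B" "card A = order a p" "card B = order b p"
      "a \<noteq> b \<Longrightarrow> A \<inter> B = {}"
    and \<tau>: "inj \<tau>" "\<And>k m. k \<in> A \<union> B \<Longrightarrow> poly p (r k m) = \<tau> m"
    and lim: "\<And>k. k \<in> A \<Longrightarrow> r k \<longlonglongrightarrow> a" "\<And>k. k \<in> B \<Longrightarrow> r k \<longlonglongrightarrow> b"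
    and relation: "\<And>f m. (\<And>i. ((\<lambda>z. poly p z ^ i * poly (pderiv f) z) has_contour_integral 0) (linepath a b)) \<Longrightarrow>
        (\<Sum>k\<in>A. poly f (r k m)) / of_nat (order a p) = (\<Sum>k\<in>B. poly f (r k m)) / of_nat (order b p)"
  proof (rule moment_vanishing_root_relation[OF deg ab], goal_cases)
    case (1 A B r \<tau>)
    show ?case by (rule that[OF 1(2-)])
  qed
  \<comment> \<open>The derivative of Q^(l+1) is (l+1) Q^l Q', so exponents l up to d_a + d_b - 2
    cover every positive j < d_a + d_b, and j = 0 is trivial. This gives as many moments as there
    are labels in A and B, the number that the Vandermonde argument consumes.\<close>
  have moments: "((\<lambda>z. poly p z ^ i * poly (pderiv (Q ^ j)) z) has_contour_integral 0) (linepath a b)"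
    if j: "j < order a p + order b p" for i j
  proof (cases j)
    case (Suc l)
    then have l: "l \<le> point_multiplicity P a + point_multiplicity P b - 2"
      using j by (simp add: mult)
    have "((\<lambda>z. poly P z ^ i * (poly Q z ^ l * poly (pderiv Q) z)) has_contour_integral 0) \<gamma>" for i
      using assms(7)[OF l] by (simp add: mult.assoc)
    from moments_shift[OF this, of "poly P a" i]
    have int: "((\<lambda>z. poly p z ^ i * (poly Q z ^ l * poly (pderiv Q) z)) has_contour_integral 0) \<gamma>"
      by (simp add: p_def)
    have hol: "(\<lambda>z. poly p z ^ i * (poly Q z ^ l * poly (pderiv Q) z)) holomorphic_on UNIV"
      by (intro holomorphic_intros)
    have "((\<lambda>z. poly p z ^ i * (poly Q z ^ l * poly (pderiv Q) z)) has_contour_integral 0)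
        (linepath a b)"
      using has_contour_integral_linepath_of_entire[OF hol assms(4) int] by (simp only: assms(5,6))
    from has_contour_integral_lmul[OF this, of "of_nat (Suc l)"]
    show ?thesis unfolding Suc pderiv_power_Suc by (simp add: mult_ac del: of_nat_Suc)
  qed (simp add: has_contour_integral_0)
  have "A \<noteq> {}" using AB(3) pos(1) by auto
  then obtain k0 where k0: "k0 \<in> A" by blast
  have "\<exists>l\<in>B. poly Q (r l m) = poly Q (r k0 m)" for m
  proof (rule common_fibre_value[OF AB(1,2) AB(5)[OF assms(2)] k0])
    fix j assume "j < card A + card B"
    then have "j < order a p + order b p" by (simp add: AB(3,4))
    from relation[OF moments[OF this], of m]
    show "(\<Sum>k\<in>A. poly Q (r k m) ^ j) / of_nat (card A) = (\<Sum>k\<in>B. poly Q (r k m) ^ j) / of_nat (card B)"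
      by (simp add: AB(3,4))
  qed
  then have "\<forall>m. \<exists>l. l \<in> B \<and> poly Q (r l m) = poly Q (r k0 m)" by blast
  from choice[OF this] obtain h where h: "\<And>m. h m \<in> B" "\<And>m. poly Q (r (h m) m) = poly Q (r k0 m)"
    by blast
  \<comment> \<open>The partner \<open>h m\<close> near b may vary with m; along a subsequence it is
    a fixed label l, which yields two convergent root sequences.\<close>
  obtain l e where l: "l \<in> B" and e: "strict_mono (e :: nat \<Rightarrow> nat)" "\<And>n. h (e n) = l"
    by (rule infinite_constant_subsequence[of B h, OF AB(2) h(1)]) blast
  show ?thesis
  proof (rule common_right_factor_of_coincident_sequences[OF assms(1)])
    show "(\<lambda>n. r k0 (e n)) \<longlonglongrightarrow> a" "(\<lambda>n. r l (e n)) \<longlonglongrightarrow> b"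
      using LIMSEQ_subseq_LIMSEQ[OF lim(1)[OF k0] e(1)] LIMSEQ_subseq_LIMSEQ[OF lim(2)[OF l] e(1)]
      by (simp_all add: o_def)
    show "inj (\<lambda>n. r k0 (e n))"
    proof (rule injI)
      fix m n assume "r k0 (e m) = r k0 (e n)"
      then have "\<tau> (e m) = \<tau> (e n)" using \<tau>(2)[of k0 "e m"] \<tau>(2)[of k0 "e n"] k0 by simp
      then have "e m = e n" by (rule injD[OF \<tau>(1)])
      then show "m = n" by (rule injD[OF strict_mono_imp_inj_on[OF e(1)]])
    qed
    fix n
    have "poly p (r k0 (e n)) = poly p (r l (e n))"
      using \<tau>(2)[of k0 "e n"] \<tau>(2)[of l "e n"] k0 l by simp
    then show "poly P (r k0 (e n)) = poly P (r l (e n))" by (simp add: p_def)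
    show "poly Q (r k0 (e n)) = poly Q (r l (e n))" using h(2)[of "e n"] e(2)[of n] by simp
  qed
qed

end
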